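(* Let $c\ge 1$ and $n\ge 0$ be integers. (1) The regular representation of $\mathbb{C}P_{n,c}$ (the algebra acting on itself by left multiplication) decomposes into irreducible $\mathbb{C}P_{n,c}$-modules as $$\mathbb{C}P_{n,c}=\bigoplus_{k=0}^{n}W^{n,k}=\bigoplus_{k=0}^{n}\ \bigoplus_{T\in X_{n,k}}W^{n}_T\ \cong\bigoplus_{n_0+\cdots+n_c=n}\binom{n}{n_0,\ldots,n_c}\,W^n_{n_0,\ldots,n_c},$$ where the first two equalities are internal direct sums of submodules, $X_{n,k}=\{T\in X_n \mid \sum_{i=1}^c|T_i|=k\}$, the last sum is over all tuples of non-negative integers $(n_0,\ldots,n_c)$ with sum $n$, and $mW$ denotes the direct sum of $m$ copies of $W$. (2) The set $\{W^{n}_{n_0,\ldots,n_c}\mid n_0+\cdots+n_c=n\}$ (with $n_0,\dots,n_c$ non-negative integers) is a complete set of irreducible $\mathbb{C}P_{n,c}$-modules up to isomorphism: each member is irreducible, and every irreducible $\mathbb{C}P_{n,c}$-module is isomorphic to a member of it.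
   Context: Fix colors $u_1,\ldots,u_c$. For $n\ge1$, $P_{n,c}$ is the set of diagrams consisting of a top row and a bottom row of $n$ vertices (each row numbered $1,\ldots,n$) together with edges, each joining a top vertex to a bottom vertex and colored with one of the $c$ colors, such that each vertex is incident to at most one edge and no two edges of the same color cross (if top $i$–bottom $j$ and top $i'$–bottom $j'$ are edges of the same color with $i<i'$, then $j<j'$). $P_{0,c}=\{\emptyset\}$ consists of the single empty diagram. The product $d_1d_2$ is obtained by stacking $d_1$ on top of $d_2$, identifying the bottom vertices of $d_1$ with the top vertices of $d_2$; the edges of $d_1d_2$ are exactly the monochromatic paths from the top of $d_1$ to the bottom of $d_2$ (with that color). This makes $P_{n,c}$ a semigroup. $\mathbb{C}P_{n,c}$ is the $\mathbb{C}$-algebra with basis $P_{n,c}$ and multiplication extended bilinearly; it is associative and unital. Modules are left unital modules; a nonzero module is irreducible if it has no proper nonzero submodule. For $d\in P_{n,c}$, $\mathrm{size}(d)$ is the number of edges of $d$. Write $d'\subseteq d$ if every edge of $d'$ is an edge of $d$ with the same color. Set $x_d=\sum_{d'\subseteq d}(-1)^{\mathrm{size}(d)-\mathrm{size}(d')}d'$. Let $\beta(d)=(\beta_0(d),\ldots,\beta_c(d))$, where $\beta_0(d)\subseteq\{1,\dots,n\}$ is the set of isolated bottom vertices and, for $1\le i\le c$, $\beta_i(d)$ is the set of bottom vertices incident to an edge colored $u_i$. Let $X_n=\{\beta(d)\mid d\in P_{n,c}\}$, and write $T=(T_0,\ldots,T_c)$ for $T\in X_n$. Define $W^{n,k}=\mathbb{C}\text{-span}\{x_a\mid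 a\in P_{n,c},\ \mathrm{size}(a)=k\}$ and, for $T\in X_n$, $W^n_T=\mathbb{C}\text{-span}\{x_a\mid a\in P_{n,c},\ \beta(a)=T\}$, which are $\mathbb{C}P_{n,c}$-modules under left multiplication. The modules $W^n_T$ with the same values $|T_0|,\dots,|T_c|$ are isomorphic, and $W^n_{n_0,\ldots,n_c}$ denotes a representative of the isomorphism class of the $W^n_T$ with $|T_i|=n_i$ for all $i\in\{0,\ldots,c\}$. *)

theory Defs
  imports
    "HOL-Algebra.Module"
    "HOL-Library.Function_Algebras"
    Complex_Main
begin

subsection \<open>Left modules over a not necessarily commutative ring\<close>

text \<open>
  The locale \<^verbatim>\<open>module\<close> of HOL-Algebra requires a commutative ring of scalars, so it does not
  cover the algebras considered here; its record type and the locale \<^verbatim>\<open>submodule\<close> do not have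
  this restriction and are reused. The fields \<^verbatim>\<open>mult\<close> and \<^verbatim>\<open>one\<close> that the module record
  inherits from the ring record play no role. Scalars from the complex numbers need no separate
  treatment: a unital module over a unital complex algebra is a complex vector space via
  the multiples of the unit, and all submodules and homomorphisms are then complex linear.
\<close>

locale left_module = R?: ring R + M?: abelian_group M
  for R (structure) and M :: "('a, 'b, 'm) module_scheme" (structure) +
  assumes smult_closed:
      "\<lbrakk>a \<in> carrier R; x \<in> carrier M\<rbrakk> \<Longrightarrow> a \<odot>\<^bsub>M\<^esub> x \<in> carrier M"
    and smult_l_distr:
      "\<lbrakk>a \<in> carrier R; b \<in> carrier R; x \<in> carrier M\<rbrakk> \<Longrightarrow>
      (a \<oplus>\<^bsub>R\<^esub> b) \<odot>\<^bsub>M\<^esub> x = a \<odot>\<^bsub>M\<^esub> x \<oplus>\<^bsub>M\<^esub> b \<odot>\<^bsub>M\<^esub> x"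
    and smult_r_distr:
      "\<lbrakk>a \<in> carrier R; x \<in> carrier M; y \<in> carrier M\<rbrakk> \<Longrightarrow>
      a \<odot>\<^bsub>M\<^esub> (x \<oplus>\<^bsub>M\<^esub> y) = a \<odot>\<^bsub>M\<^esub> x \<oplus>\<^bsub>M\<^esub> a \<odot>\<^bsub>M\<^esub> y"
    and smult_assoc:
      "\<lbrakk>a \<in> carrier R; b \<in> carrier R; x \<in> carrier M\<rbrakk> \<Longrightarrow>
      (a \<otimes>\<^bsub>R\<^esub> b) \<odot>\<^bsub>M\<^esub> x = a \<odot>\<^bsub>M\<^esub> (b \<odot>\<^bsub>M\<^esub> x)"
    and smult_one:
      "x \<in> carrier M \<Longrightarrow> \<one>\<^bsub>R\<^esub> \<odot>\<^bsub>M\<^esub> x = x"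

abbreviation restrict_module ::
    "('a, 'b, 'm) module_scheme \<Rightarrow> 'b set \<Rightarrow> ('a, 'b, 'm) module_scheme"
  where "restrict_module M H \<equiv> M\<lparr>carrier := H\<rparr>"

definition regular_module :: "('a, 'r) ring_scheme \<Rightarrow> ('a, 'a) module"
  where "regular_module R =
    \<lparr>carrier = carrier R, monoid.mult = mult R, one = one R, zero = zero R, add = add R,
     smult = mult R\<rparr>"

definition irreducible_module :: "('a, 'r) ring_scheme \<Rightarrow> ('a, 'b, 'm) module_scheme \<Rightarrow> bool"
  where "irreducible_module R M \<longleftrightarrow>
    left_module R M \<and> carrier M \<noteq> {\<zero>\<^bsub>M\<^esub>} \<and>
    (\<forall>H. submodule H R M \<longrightarrow> H = {\<zero>\<^bsub>M\<^esub>} \<or> H = carrier M)"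

definition module_isomorphic ::
    "('a, 'r) ring_scheme \<Rightarrow> ('a, 'b, 'm) module_scheme \<Rightarrow> ('a, 'c, 'n) module_scheme \<Rightarrow> bool"
  where "module_isomorphic R M N \<longleftrightarrow>
    left_module R M \<and> left_module R N \<and>
    (\<exists>\<phi> \<in> iso (add_monoid M) (add_monoid N).
      \<forall>a \<in> carrier R. \<forall>x \<in> carrier M. \<phi> (a \<odot>\<^bsub>M\<^esub> x) = a \<odot>\<^bsub>N\<^esub> \<phi> x)"

definition internal_direct_sum ::
    "('a, 'r) ring_scheme \<Rightarrow> ('a, 'b, 'm) module_scheme \<Rightarrow> 'i set \<Rightarrow> ('i \<Rightarrow> 'b set) \<Rightarrow> bool"
  where "internal_direct_sum R M I N \<longleftrightarrow>
    left_module R M \<and> finite I \<and> (\<forall>i\<in>I. submodule (N i) R M) \<and>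
    (\<forall>x \<in> carrier M. \<exists>!f. f \<in> (\<Pi>\<^sub>E i\<in>I. N i) \<and> x = finsum M f I)"

definition direct_sum_module ::
    "'i set \<Rightarrow> ('i \<Rightarrow> ('a, 'b, 'm) module_scheme) \<Rightarrow> ('a, 'i \<Rightarrow> 'b) module"
  where "direct_sum_module I M =
    \<lparr>carrier = {f \<in> (\<Pi>\<^sub>E i\<in>I. carrier (M i)). finite {i \<in> I. f i \<noteq> \<zero>\<^bsub>M i\<^esub>}},
     monoid.mult = undefined, one = undefined,
     zero = (\<lambda>i\<in>I. \<zero>\<^bsub>M i\<^esub>),
     add = (\<lambda>f g. \<lambda>i\<in>I. f i \<oplus>\<^bsub>M i\<^esub> g i),
     smult = (\<lambda>a f. \<lambda>i\<in>I. a \<odot>\<^bsub>M i\<^esub> f i)\<rparr>"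


subsection \<open>Coloured planar rook diagrams\<close>

text \<open>
  A diagram is identified with its set of edges; the triple \<open>(i, j, r)\<close> is the edge of
  colour \<open>r\<close> that joins the top vertex \<open>i\<close> to the bottom vertex \<open>j\<close>. Colours are
  the numbers from 1 to \<open>c\<close>. For \<open>n = 0\<close> the only diagram is the empty set.
\<close>

type_synonym diagram = "(nat \<times> nat \<times> nat) set"

definition Pnc :: "nat \<Rightarrow> nat \<Rightarrow> diagram set"
  where "Pnc n c = {d. d \<subseteq> {1..n} \<times> {1..n} \<times> {1..c} \<and>
    (\<forall>i j r j' r'. (i, j, r) \<in> d \<and> (i, j', r') \<in> d \<longrightarrow> (j, r) = (j', r')) \<and>
    (\<forall>i j r i' r'. (i, j, r) \<in> d \<and> (i', j, r') \<in> d \<longrightarrow> (i, r) = (i', r')) \<and>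
    (\<forall>i j i' j' r. (i, j, r) \<in> d \<and> (i', j', r) \<in> d \<and> i < i' \<longrightarrow> j < j')}"

definition diagram_mult :: "diagram \<Rightarrow> diagram \<Rightarrow> diagram"
  where "diagram_mult d1 d2 = {(i, j, r). \<exists>m. (i, m, r) \<in> d1 \<and> (m, j, r) \<in> d2}"

abbreviation diagram_size :: "diagram \<Rightarrow> nat"
  where "diagram_size d \<equiv> card d"


subsection \<open>The algebra\<close>

text \<open>
  A linear combination of diagrams is represented by its coefficient function, which vanishes
  outside \<open>Pnc n c\<close>. For \<open>c > 1\<close> and \<open>n > 0\<close> the unit is not a diagram but a linear combination
  of diagrams.
\<close>

definition CP_carrier :: "nat \<Rightarrow> nat \<Rightarrow> (diagram \<Rightarrow> complex) set"
  where "CP_carrier n c = {f. \<forall>d. d \<notin> Pnc n c \<longrightarrow> f d = 0}"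

definition CP_mult ::
    "nat \<Rightarrow> nat \<Rightarrow> (diagram \<Rightarrow> complex) \<Rightarrow> (diagram \<Rightarrow> complex) \<Rightarrow> diagram \<Rightarrow> complex"
  where "CP_mult n c f g =
    (\<lambda>d. \<Sum>(d1, d2) \<in> {(d1, d2) \<in> Pnc n c \<times> Pnc n c. diagram_mult d1 d2 = d}. f d1 * g d2)"

definition CP :: "nat \<Rightarrow> nat \<Rightarrow> (diagram \<Rightarrow> complex) ring"
  where "CP n c =
    \<lparr>carrier = CP_carrier n c,
     monoid.mult = CP_mult n c,
     one = (THE u. u \<in> CP_carrier n c \<and>
       (\<forall>f \<in> CP_carrier n c. CP_mult n c u f = f \<and> CP_mult n c f u = f)),
     zero = (\<lambda>d. 0),
     add = (\<lambda>f g d. f d + g d)\<rparr>"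

definition basis_vector :: "diagram \<Rightarrow> diagram \<Rightarrow> complex"
  where "basis_vector d = (\<lambda>e. if e = d then 1 else 0)"

definition complex_span :: "(diagram \<Rightarrow> complex) set \<Rightarrow> (diagram \<Rightarrow> complex) set"
  where "complex_span = module.span (\<lambda>a f d. a * f d)"


subsection \<open>The modules\<close>

definition xd :: "nat \<Rightarrow> nat \<Rightarrow> diagram \<Rightarrow> diagram \<Rightarrow> complex"
  where "xd n c d = (\<lambda>e. \<Sum>d' \<in> {d' \<in> Pnc n c. d' \<subseteq> d}.
    (-1) ^ (diagram_size d - diagram_size d') * basis_vector d' e)"

text \<open>The tuple \<open>(T\<^sub>0, \<dots>, T\<^sub>c)\<close> is a list of length \<open>c + 1\<close>.\<close>

definition beta :: "nat \<Rightarrow> nat \<Rightarrow> diagram \<Rightarrow> nat set list"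
  where "beta n c d =
    {j \<in> {1..n}. \<not> (\<exists>i r. (i, j, r) \<in> d)} #
    map (\<lambda>r. {j \<in> {1..n}. \<exists>i. (i, j, r) \<in> d}) [1..<Suc c]"

definition Xn :: "nat \<Rightarrow> nat \<Rightarrow> nat set list set"
  where "Xn n c = beta n c ` Pnc n c"

definition Xnk :: "nat \<Rightarrow> nat \<Rightarrow> nat \<Rightarrow> nat set list set"
  where "Xnk n c k = {T \<in> Xn n c. (\<Sum>i = 1..c. card (T ! i)) = k}"

definition Wnk :: "nat \<Rightarrow> nat \<Rightarrow> nat \<Rightarrow> (diagram \<Rightarrow> complex) set"
  where "Wnk n c k = complex_span {xd n c a | a. a \<in> Pnc n c \<and> diagram_size a = k}"

definition WnT :: "nat \<Rightarrow> nat \<Rightarrow> nat set list \<Rightarrow> (diagram \<Rightarrow> complex) set"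
  where "WnT n c T = complex_span {xd n c a | a. a \<in> Pnc n c \<and> beta n c a = T}"

abbreviation W_module ::
    "nat \<Rightarrow> nat \<Rightarrow> nat set list \<Rightarrow> (diagram \<Rightarrow> complex, diagram \<Rightarrow> complex) module"
  where "W_module n c T \<equiv> restrict_module (regular_module (CP n c)) (WnT n c T)"

definition weak_compositions :: "nat \<Rightarrow> nat \<Rightarrow> nat list set"
  where "weak_compositions n c = {ns. length ns = c + 1 \<and> sum_list ns = n}"

definition multinomial :: "nat list \<Rightarrow> nat"
  where "multinomial ns = fact (sum_list ns) div prod_list (map fact ns)"

text \<open>
  The module attached to a tuple \<open>ns\<close> is only determined up to isomorphism. An admissible
  choice \<open>\<tau>\<close> of representatives picks, for each \<open>ns\<close>, any \<open>T\<close> whose sets have the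
  sizes prescribed by \<open>ns\<close>.
\<close>

definition is_choice :: "nat \<Rightarrow> nat \<Rightarrow> (nat list \<Rightarrow> nat set list) \<Rightarrow> bool"
  where "is_choice n c \<tau> \<longleftrightarrow>
    (\<forall>ns \<in> weak_compositions n c. \<tau> ns \<in> Xn n c \<and> map card (\<tau> ns) = ns)"

lemma ex_count_list: "\<exists>L. length L = sum_list ns \<and> (\<forall>i < length ns. count_list L i = ns ! i) \<and>
    set L \<subseteq> {..<length ns}"
proof (induction ns rule: rev_induct)
  case Nil
  show ?case by simp
next
  case (snoc a ns)
  then obtain L where L: "length L = sum_list ns" "\<forall>i < length ns. count_list L i = ns ! i"
    "set L \<subseteq> {..<length ns}" by blast
  have "count_list (replicate a (length ns)) i = (if i = length ns then a else 0)" for i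
    by (induction a) auto
  moreover have "count_list L (length ns) = 0"
    using L(3) by (auto simp: count_list_0_iff)
  ultimately have "\<forall>i < length (ns @ [a]). count_list (L @ replicate a (length ns)) i = (ns @ [a]) ! i"
    using L(2) by (auto simp: nth_append less_Suc_eq)
  moreover have "length (L @ replicate a (length ns)) = sum_list (ns @ [a])"
    using L(1) by simp
  moreover have "set (L @ replicate a (length ns)) \<subseteq> {..<length (ns @ [a])}"
    using L(3) by (auto simp: less_Suc_eq)
  ultimately show ?case by (intro exI[of _ "L @ replicate a (length ns)"] conjI)
qed

lemma ex_type: assumes "ns \<in> weak_compositions n c"
  shows "\<exists>T \<in> Xn n c. map card T = ns"
proof -
  have ns: "length ns = c + 1" "sum_list ns = n"
    using assms by (auto simp: weak_compositions_def)
  obtain L where L: "length L = n" "\<And>i. i \<le> c \<Longrightarrow> count_list L i = ns ! i" "set L \<subseteq> {..c}"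
    using ex_count_list[of ns] ns by (auto simp: lessThan_Suc_atMost)
  define f where "f j = L ! (j - 1)" for j
  have f: "f j \<le> c" if "j \<in> {1..n}" for j
  proof -
    have "L ! (j - 1) \<in> set L"
      using that L(1) by (intro nth_mem) auto
    then show ?thesis using L(3) by (auto simp: f_def)
  qed
  have cf: "card {j \<in> {1..n}. f j = i} = ns ! i" if "i \<le> c" for i
  proof -
    have "{j \<in> {1..n}. f j = i} = Suc ` {j. j < n \<and> L ! j = i}"
    proof (intro equalityI subsetI)
      fix j assume "j \<in> {j \<in> {1..n}. f j = i}"
      then have "j = Suc (j - 1)" "j - 1 \<in> {j. j < n \<and> L ! j = i}"
        by (auto simp: f_def)
      then show "j \<in> Suc ` {j. j < n \<and> L ! j = i}" by (rule image_eqI)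
    qed (auto simp: f_def)
    then have "card {j \<in> {1..n}. f j = i} = card (Suc ` {j. j < n \<and> L ! j = i})"
      by simp
    also have "\<dots> = card {j. j < n \<and> L ! j = i}"
      by (rule card_image) simp
    also have "\<dots> = count_list L i"
      using L(1) by (simp add: count_list_eq_length_filter length_filter_conv_card eq_commute)
    finally show ?thesis using L(2)[OF that] by simp
  qed
  define d where "d = {(j, j, f j) | j. j \<in> {1..n} \<and> f j \<noteq> 0}"
  have "d \<in> Pnc n c"
  proof -
    have "d \<subseteq> {1..n} \<times> {1..n} \<times> {1..c}"
    proof
      fix e assume "e \<in> d"
      then obtain j where "e = (j, j, f j)" "j \<in> {1..n}" "f j \<noteq> 0"
        by (auto simp: d_def)
      then show "e \<in> {1..n} \<times> {1..n} \<times> {1..c}"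
        using f[of j] by auto
    qed
    moreover have e: "(i, j, r) \<in> d \<longleftrightarrow> j = i \<and> r = f i \<and> i \<in> {1..n} \<and> f i \<noteq> 0" for i j r
      unfolding d_def by blast
    ultimately show ?thesis
      unfolding Pnc_def mem_Collect_eq e by (intro conjI allI impI) simp_all
  qed
  have b: "beta n c d =
      {j \<in> {1..n}. f j = 0} # map (\<lambda>r. {j \<in> {1..n}. f j = r}) [1..<Suc c]"
    unfolding beta_def
  proof (intro arg_cong2[where f = Cons] map_cong refl)
    show "{j \<in> {1..n}. \<not> (\<exists>i r. (i, j, r) \<in> d)} = {j \<in> {1..n}. f j = 0}"
      unfolding d_def by blast
    show "{j \<in> {1..n}. \<exists>i. (i, j, r) \<in> d} = {j \<in> {1..n}. f j = r}"
      if "r \<in> set [1..<Suc c]" for r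
    proof -
      have "r \<noteq> 0" using that by auto
      then show ?thesis unfolding d_def by blast
    qed
  qed
  have "map card (beta n c d) = ns"
  proof (rule nth_equalityI)
    show "length (map card (beta n c d)) = length ns"
      using ns(1) by (simp add: beta_def del: upt_Suc)
  next
    fix i assume "i < length (map card (beta n c d))"
    then have i: "i \<le> c" by (simp add: beta_def del: upt_Suc)
    then show "map card (beta n c d) ! i = ns ! i"
      using cf[OF i] unfolding b by (cases i) (simp_all del: upt_Suc)
  qed
  with \<open>d \<in> Pnc n c\<close> show ?thesis
    unfolding Xn_def by blast
qed

lemma ex_choice: "\<exists>\<tau>. is_choice n c \<tau>"
proof -
  have "\<forall>ns \<in> weak_compositions n c. \<exists>T. T \<in> Xn n c \<and> map card T = ns"
    using ex_type by blast
  from bchoice[OF this] show ?thesis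
    unfolding is_choice_def .
qed

end

theory Submission
  imports Defs "HOL-Algebra.Coset" "HOL-Library.Disjoint_Sets"
begin

text \<open>
  For a linear combination \<open>f\<close> of diagrams, the coefficient of \<open>x\<^sub>a\<close> is the sum of \<open>f d\<close> over
  all \<open>d\<close> containing \<open>a\<close>. A diagram is determined by the colour types \<open>S\<close>, \<open>T\<close> of its top and
  bottom rows, and such a diagram exists iff \<open>S\<close> and \<open>T\<close> have the same cardinalities, since
  edges of one colour must match vertices of equal rank. An inclusion of \<open>a\<close> in a product \<open>d e\<close>
  factors uniquely through a middle row, so in these coordinates the product is matrix
  multiplication: the algebra is the algebra of matrices over \<open>X\<^sub>n\<close> that are block diagonal with
  respect to the equivalence \<open>|S\<^sub>i| = |T\<^sub>i|\<close> for all \<open>i\<close>, and \<open>W\<^sub>T\<close> is the column indexed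
  by \<open>T\<close>. The theorem is then the elementary representation theory of block diagonal matrices.
\<close>

subsection \<open>Left modules\<close>

text \<open>The coefficients with respect to the vectors x_a come from Moebius inversion: every
  subset of a diagram is again a diagram, so a full Boolean lattice lies below \<open>a\<close>, and
  the signs in x_a are its Moebius function. The obstacle is that stacking diagrams loses edges, so
  a product of two basis diagrams may be smaller than both. Counting the diagrams that contain a
  fixed \<open>a\<close> turns this loss into the condition that \<open>a\<close> survives in the
  product, and a surviving \<open>a\<close> dictates the middle row through which it passes.
  Associativity and the unit are read off from matrices, not from diagrams; the unit is the preimage
  of the identity matrix. For an arbitrary irreducible module N, the unit is the sum of the diagonal
  matrix units, so one of them acts nontrivially on a chosen nonzero vector, and this yields a
  nonzero map from a column to N. The multinomial coefficient is the number of columns in one class,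
  that is, of ordered set partitions with prescribed block sizes.\<close>

lemma (in left_module) smult_zero_left:
  assumes "x \<in> carrier M"
  shows "\<zero>\<^bsub>R\<^esub> \<odot>\<^bsub>M\<^esub> x = \<zero>\<^bsub>M\<^esub>"
proof -
  have "\<zero>\<^bsub>R\<^esub> \<odot>\<^bsub>M\<^esub> x \<oplus>\<^bsub>M\<^esub> \<zero>\<^bsub>R\<^esub> \<odot>\<^bsub>M\<^esub> x = \<zero>\<^bsub>R\<^esub> \<odot>\<^bsub>M\<^esub> x"
    using smult_l_distr[of "\<zero>\<^bsub>R\<^esub>" "\<zero>\<^bsub>R\<^esub>" x] assms by simp
  then show ?thesis
    using M.add.r_cancel_one smult_closed[of "\<zero>\<^bsub>R\<^esub>" x] assms by simp
qed

lemma (in left_module) smult_zero_right: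
  assumes "a \<in> carrier R"
  shows "a \<odot>\<^bsub>M\<^esub> \<zero>\<^bsub>M\<^esub> = \<zero>\<^bsub>M\<^esub>"
proof -
  have "a \<odot>\<^bsub>M\<^esub> \<zero>\<^bsub>M\<^esub> \<oplus>\<^bsub>M\<^esub> a \<odot>\<^bsub>M\<^esub> \<zero>\<^bsub>M\<^esub> = a \<odot>\<^bsub>M\<^esub> \<zero>\<^bsub>M\<^esub>"
    using smult_r_distr[of a "\<zero>\<^bsub>M\<^esub>" "\<zero>\<^bsub>M\<^esub>"] assms by simp
  then show ?thesis
    using M.add.r_cancel_one smult_closed[of a "\<zero>\<^bsub>M\<^esub>"] assms by simp
qed

lemma (in left_module) smult_minus_one:
  assumes "x \<in> carrier M"
  shows "(\<ominus>\<^bsub>R\<^esub> \<one>\<^bsub>R\<^esub>) \<odot>\<^bsub>M\<^esub> x = \<ominus>\<^bsub>M\<^esub> x"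
proof -
  have "(\<ominus>\<^bsub>R\<^esub> \<one>\<^bsub>R\<^esub>) \<odot>\<^bsub>M\<^esub> x \<oplus>\<^bsub>M\<^esub> x = \<zero>\<^bsub>M\<^esub>"
    using smult_l_distr[of "\<ominus>\<^bsub>R\<^esub> \<one>\<^bsub>R\<^esub>" "\<one>\<^bsub>R\<^esub>" x] assms smult_one smult_zero_left
    by (simp add: R.l_neg)
  then show ?thesis
    using assms M.minus_equality smult_closed by simp
qed

text \<open>Negatives come for free: -x is the multiple of x by the scalar -1, so closure under
  scalars covers inverses.\<close>

lemma (in left_module) submoduleI:
  assumes "H \<subseteq> carrier M" "\<zero>\<^bsub>M\<^esub> \<in> H"
    and "\<And>x y. x \<in> H \<Longrightarrow> y \<in> H \<Longrightarrow> x \<oplus>\<^bsub>M\<^esub> y \<in> H"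
    and "\<And>a x. a \<in> carrier R \<Longrightarrow> x \<in> H \<Longrightarrow> a \<odot>\<^bsub>M\<^esub> x \<in> H"
  shows "submodule H R M"
proof (intro submodule.intro subgroup.intro submodule_axioms.intro)
  fix x assume "x \<in> H"
  then have "\<ominus>\<^bsub>M\<^esub> x \<in> H"
    using smult_minus_one[of x] assms(1,4) by (metis R.a_inv_closed R.one_closed subsetD)
  then show "inv\<^bsub>add_monoid M\<^esub> x \<in> H"
    by (simp add: a_inv_def)
qed (use assms in auto)

lemma left_module_restrict:
  assumes "left_module R M" "submodule H R M"
  shows "left_module R (restrict_module M H)"
proof -
  interpret left_module R M by fact
  interpret H: submodule H R M by fact
  have sub: "H \<subseteq> carrier M"
    using H.subset by simp
  have "abelian_group (restrict_module M H)"
  proof (rule abelian_groupI)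
    fix x assume "x \<in> carrier (restrict_module M H)"
    then show "\<exists>y\<in>carrier (restrict_module M H).
        y \<oplus>\<^bsub>restrict_module M H\<^esub> x = \<zero>\<^bsub>restrict_module M H\<^esub>"
      using sub H.m_inv_closed[of x] M.l_neg[of x]
      by (auto simp: a_inv_def intro!: bexI[of _ "inv\<^bsub>add_monoid M\<^esub> x"])
  qed (use sub H.m_closed H.one_closed M.a_assoc M.a_comm in \<open>auto simp: subset_iff\<close>)
  then show ?thesis
    using sub H.smult_closed smult_l_distr smult_r_distr smult_assoc smult_one
    by (intro left_module.intro left_module_axioms.intro R.ring_axioms)
       (simp_all add: subset_iff)
qed

lemma left_module_regular:
  assumes "ring R"
  shows "left_module R (regular_module R)"
proof -
  interpret ring R by fact
  have "abelian_group (regular_module R)"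
  proof (rule abelian_groupI)
    fix x assume "x \<in> carrier (regular_module R)"
    then show "\<exists>y\<in>carrier (regular_module R).
        y \<oplus>\<^bsub>regular_module R\<^esub> x = \<zero>\<^bsub>regular_module R\<^esub>"
      by (auto simp: regular_module_def intro!: bexI[of _ "\<ominus>\<^bsub>R\<^esub> x"] l_neg)
  qed (auto simp: regular_module_def a_ac)
  then show ?thesis
    by (intro left_module.intro left_module_axioms.intro ring_axioms)
       (auto simp: regular_module_def l_distr r_distr m_assoc)
qed

text \<open>With \<open>I\<close> finite the finite-support clause in
  \<open>direct_sum_module\<close> holds automatically, and each axiom is checked coordinatewise.
  Membership in \<open>extensional\<close> makes equality on \<open>I\<close> the same as equality
  of functions.\<close>

lemma left_module_direct_sum:
  assumes "ring R" "finite I" "\<And>i. i \<in> I \<Longrightarrow> left_module R (N i)"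
  shows "left_module R (direct_sum_module I N)"
proof -
  interpret ring R by fact
  have ag: "abelian_group (N i)" if "i \<in> I" for i
    using assms(3)[OF that] by (rule left_module.axioms)
  have am: "abelian_monoid (N i)" if "i \<in> I" for i
    using ag[OF that] by (rule abelian_group.axioms)
  have "abelian_group (direct_sum_module I N)"
  proof (rule abelian_groupI)
    fix f assume f: "f \<in> carrier (direct_sum_module I N)"
    have "(\<lambda>i\<in>I. \<ominus>\<^bsub>N i\<^esub> f i) \<in> carrier (direct_sum_module I N)"
      using f assms(2) ag
      by (auto simp: direct_sum_module_def PiE_iff abelian_group.a_inv_closed)
    moreover have "(\<lambda>i\<in>I. \<ominus>\<^bsub>N i\<^esub> f i) \<oplus>\<^bsub>direct_sum_module I N\<^esub> f
        = \<zero>\<^bsub>direct_sum_module I N\<^esub>"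
      using f ag
      by (auto simp: direct_sum_module_def PiE_iff abelian_group.l_neg intro!: restrict_ext)
    ultimately show "\<exists>g\<in>carrier (direct_sum_module I N).
        g \<oplus>\<^bsub>direct_sum_module I N\<^esub> f = \<zero>\<^bsub>direct_sum_module I N\<^esub>"
      by blast
  next
    fix f assume f: "f \<in> carrier (direct_sum_module I N)"
    then show "\<zero>\<^bsub>direct_sum_module I N\<^esub> \<oplus>\<^bsub>direct_sum_module I N\<^esub> f = f"
      using am
      by (auto simp: direct_sum_module_def PiE_iff abelian_monoid.l_zero extensional_def
          restrict_def)
  next
    fix f g assume "f \<in> carrier (direct_sum_module I N)" "g \<in> carrier (direct_sum_module I N)"
    then show "f \<oplus>\<^bsub>direct_sum_module I N\<^esub> g = g \<oplus>\<^bsub>direct_sum_module I N\<^esub> f"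
      using am by (auto simp: direct_sum_module_def PiE_iff intro!: restrict_ext
          abelian_monoid.a_comm)
  qed (use assms(2) am in \<open>auto simp: direct_sum_module_def PiE_iff abelian_monoid.a_closed
      abelian_monoid.zero_closed abelian_monoid.a_assoc
      intro!: restrict_ext\<close>)
  moreover have "left_module_axioms R (direct_sum_module I N)"
    using assms(2) left_module.smult_closed[OF assms(3)] left_module.smult_l_distr[OF assms(3)]
      left_module.smult_r_distr[OF assms(3)] left_module.smult_assoc[OF assms(3)]
      left_module.smult_one[OF assms(3)]
    by (intro left_module_axioms.intro)
       (auto simp: direct_sum_module_def PiE_iff extensional_def restrict_def fun_eq_iff)
  ultimately show ?thesis
    by (intro left_module.intro ring_axioms)
qed

text \<open>Schur's lemma: kernel and image of \<open>\<phi>\<close> are submodules, and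
  \<open>\<phi>\<close> is nonzero, so the kernel is trivial and the image is everything. The
  conclusion is oriented from \<open>N\<close> to \<open>M\<close> because \<open>M\<close> will be
  a column and \<open>N\<close> the module to be classified.\<close>

lemma irreducible_module_iso:
  assumes irr: "irreducible_module R M" "irreducible_module R N"
    and closed: "\<And>x. x \<in> carrier M \<Longrightarrow> \<phi> x \<in> carrier N"
    and add: "\<And>x y. x \<in> carrier M \<Longrightarrow> y \<in> carrier M \<Longrightarrow> \<phi> (x \<oplus>\<^bsub>M\<^esub> y) = \<phi> x \<oplus>\<^bsub>N\<^esub> \<phi> y"
    and smult: "\<And>a x. a \<in> carrier R \<Longrightarrow> x \<in> carrier M \<Longrightarrow> \<phi> (a \<odot>\<^bsub>M\<^esub> x) = a \<odot>\<^bsub>N\<^esub> \<phi> x"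
    and nonzero: "\<exists>x\<in>carrier M. \<phi> x \<noteq> \<zero>\<^bsub>N\<^esub>"
  shows "module_isomorphic R N M"
proof -
  have M: "left_module R M" and N: "left_module R N"
    using irr by (auto simp: irreducible_module_def)
  interpret M: left_module R M by fact
  interpret N: left_module R N by fact
  let ?K = "{x \<in> carrier M. \<phi> x = \<zero>\<^bsub>N\<^esub>}"
  have zero: "\<phi> \<zero>\<^bsub>M\<^esub> = \<zero>\<^bsub>N\<^esub>"
    using smult[of "\<zero>\<^bsub>R\<^esub>" "\<zero>\<^bsub>M\<^esub>"] M.smult_zero_left[of "\<zero>\<^bsub>M\<^esub>"]
      N.smult_zero_left[of "\<phi> \<zero>\<^bsub>M\<^esub>"] closed by simp
  have "submodule ?K R M"
    by (rule M.submoduleI)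
       (use zero add smult M.smult_closed N.smult_zero_right in auto)
  then have ker: "?K = {\<zero>\<^bsub>M\<^esub>}"
    using irr(1) nonzero unfolding irreducible_module_def by blast
  have "submodule (\<phi> ` carrier M) R N"
  proof (rule N.submoduleI)
    show "\<zero>\<^bsub>N\<^esub> \<in> \<phi> ` carrier M"
      using zero by (metis M.M.zero_closed imageI)
    show "x \<oplus>\<^bsub>N\<^esub> y \<in> \<phi> ` carrier M" if "x \<in> \<phi> ` carrier M" "y \<in> \<phi> ` carrier M" for x y
      using that by (auto simp flip: add)
    show "a \<odot>\<^bsub>N\<^esub> x \<in> \<phi> ` carrier M" if "a \<in> carrier R" "x \<in> \<phi> ` carrier M" for a x
      using that by (auto simp flip: smult simp: M.smult_closed)
  qed (use closed in auto)
  then have im: "\<phi> ` carrier M = carrier N"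
    using irr(2) nonzero unfolding irreducible_module_def by blast
  have hom: "\<phi> \<in> hom (add_monoid M) (add_monoid N)"
    using closed add by (auto simp: hom_def)
  interpret g: group_hom "add_monoid M" "add_monoid N" \<phi>
    using hom by (intro group_hom.intro group_hom_axioms.intro M.M.a_group N.M.a_group) auto
  have "inj_on \<phi> (carrier M)"
    using ker g.inj_iff_trivial_ker by (auto simp: kernel_def)
  then have bij: "bij_betw \<phi> (carrier M) (carrier N)"
    using im by (auto simp: bij_betw_def)
  let ?\<psi> = "inv_into (carrier M) \<phi>"
  have "\<phi> \<in> iso (add_monoid M) (add_monoid N)"
    using hom bij by (auto simp: iso_def)
  then have "?\<psi> \<in> iso (add_monoid N) (add_monoid M)"
    using group.iso_set_sym[OF M.M.a_group, of \<phi> "add_monoid N"] by simp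
  moreover have "?\<psi> (a \<odot>\<^bsub>N\<^esub> y) = a \<odot>\<^bsub>M\<^esub> ?\<psi> y" if "a \<in> carrier R" "y \<in> carrier N" for a y
  proof -
    have c: "?\<psi> y \<in> carrier M"
      using im that(2) inv_into_into[of y \<phi> "carrier M"] by simp
    have "\<phi> (a \<odot>\<^bsub>M\<^esub> ?\<psi> y) = a \<odot>\<^bsub>N\<^esub> y"
      using smult[OF that(1) c] f_inv_into_f[of y \<phi> "carrier M"] im that(2) by simp
    then show ?thesis
      using inv_into_f_f[OF \<open>inj_on \<phi> (carrier M)\<close>, of "a \<odot>\<^bsub>M\<^esub> ?\<psi> y"]
        M.smult_closed[OF that(1) c] by simp
  qed
  ultimately show ?thesis
    unfolding module_isomorphic_def using M N by blast
qed


subsection \<open>Algebras of block matrices\<close>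

text \<open>Matrices are total functions that vanish outside the blocks, so that equality of
  matrices is plain equality of functions.\<close>

definition block_matrices :: "'i set \<Rightarrow> ('i \<Rightarrow> 'k) \<Rightarrow> ('i \<Rightarrow> 'i \<Rightarrow> 'f::zero) set"
  where "block_matrices X cls =
    {F. \<forall>S T. F S T \<noteq> 0 \<longrightarrow> S \<in> X \<and> T \<in> X \<and> cls S = cls T}"

text \<open>An additive group with a bijection to block matrices that respects sums, products and
  the unit. The ring axioms are conclusions here, transported back along \<open>mat\<close>, so that
  they never have to be verified on diagrams.\<close>

locale block_matrix_ring = abelian_group R for R :: "('a, 'r) ring_scheme" (structure) +
  fixes X :: "'i set" and cls :: "'i \<Rightarrow> 'k" and mat :: "'a \<Rightarrow> 'i \<Rightarrow> 'i \<Rightarrow> 'f::field"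
  assumes finite_X: "finite X"
    and bij_mat: "bij_betw mat (carrier R) (block_matrices X cls)"
    and mult_closed: "\<lbrakk>x \<in> carrier R; y \<in> carrier R\<rbrakk> \<Longrightarrow> x \<otimes> y \<in> carrier R"
    and one_closed': "\<one> \<in> carrier R"
    and mat_add: "\<lbrakk>x \<in> carrier R; y \<in> carrier R\<rbrakk> \<Longrightarrow> mat (x \<oplus> y) S T = mat x S T + mat y S T"
    and mat_mult: "\<lbrakk>x \<in> carrier R; y \<in> carrier R\<rbrakk> \<Longrightarrow>
      mat (x \<otimes> y) S T = (\<Sum>U\<in>X. mat x S U * mat y U T)"
    and mat_one: "mat \<one> S T = (if S = T \<and> S \<in> X then 1 else 0)"
begin

definition unmat :: "('i \<Rightarrow> 'i \<Rightarrow> 'f) \<Rightarrow> 'a"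
  where "unmat = the_inv_into (carrier R) mat"

lemma unmat_closed: "F \<in> block_matrices X cls \<Longrightarrow> unmat F \<in> carrier R"
  unfolding unmat_def
  by (rule the_inv_into_into) (use bij_mat in \<open>auto simp: bij_betw_def\<close>)

lemma mat_unmat: "F \<in> block_matrices X cls \<Longrightarrow> mat (unmat F) = F"
  unfolding unmat_def
  by (rule f_the_inv_into_f) (use bij_mat in \<open>auto simp: bij_betw_def\<close>)

lemma mat_eqI:
  assumes "x \<in> carrier R" "y \<in> carrier R" "\<And>S T. mat x S T = mat y S T"
  shows "x = y"
  using bij_mat assms unfolding bij_betw_def inj_on_def by blast

lemma mat_nonzeroD:
  assumes "x \<in> carrier R" "mat x S T \<noteq> 0"
  shows "S \<in> X" "T \<in> X" "cls S = cls T"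
  using bij_mat assms unfolding bij_betw_def block_matrices_def by blast+

lemma mat_zero: "mat \<zero> S T = 0"
  by (metis add_cancel_right_right local.l_zero mat_add zero_closed)

lemma ring_R: "ring R"
proof (rule ringI)
  show "Group.monoid R"
  proof (rule monoidI)
    fix x y z assume xyz: "x \<in> carrier R" "y \<in> carrier R" "z \<in> carrier R"
    then show "x \<otimes> y \<otimes> z = x \<otimes> (y \<otimes> z)"
    proof (intro mat_eqI)
      fix S T
      have "mat (x \<otimes> y \<otimes> z) S T = (\<Sum>U\<in>X. \<Sum>V\<in>X. mat x S V * mat y V U * mat z U T)"
        using xyz by (simp add: mat_mult mult_closed sum_distrib_right)
      also have "\<dots> = (\<Sum>V\<in>X. \<Sum>U\<in>X. mat x S V * mat y V U * mat z U T)"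
        by (rule sum.swap)
      also have "\<dots> = mat (x \<otimes> (y \<otimes> z)) S T"
        using xyz by (simp add: mat_mult mult_closed sum_distrib_left mult.assoc)
      finally show "mat (x \<otimes> y \<otimes> z) S T = mat (x \<otimes> (y \<otimes> z)) S T" .
    qed (auto intro: mult_closed)
  next
    fix x assume x: "x \<in> carrier R"
    show "\<one> \<otimes> x = x"
    proof (rule mat_eqI)
      fix S T
      have "mat (\<one> \<otimes> x) S T = (\<Sum>U\<in>X. if U = S then mat x S T else 0)"
        using x mat_nonzeroD(1)[OF x, of S T]
        by (auto simp: mat_mult mat_one one_closed' intro!: sum.cong)
      then show "mat (\<one> \<otimes> x) S T = mat x S T"
        using finite_X mat_nonzeroD(1)[OF x, of S T] by auto
    qed (use x in \<open>auto intro: mult_closed one_closed'\<close>)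
    show "x \<otimes> \<one> = x"
    proof (rule mat_eqI)
      fix S T
      have "mat (x \<otimes> \<one>) S T = (\<Sum>U\<in>X. if U = T then mat x S T else 0)"
        using x mat_nonzeroD(2)[OF x, of S T]
        by (auto simp: mat_mult mat_one one_closed' intro!: sum.cong)
      then show "mat (x \<otimes> \<one>) S T = mat x S T"
        using finite_X mat_nonzeroD(2)[OF x, of S T] by auto
    qed (use x in \<open>auto intro: mult_closed one_closed'\<close>)
  qed (auto intro: mult_closed one_closed')
next
  fix x y z assume xyz: "x \<in> carrier R" "y \<in> carrier R" "z \<in> carrier R"
  show "(x \<oplus> y) \<otimes> z = x \<otimes> z \<oplus> y \<otimes> z"
    by (rule mat_eqI)
       (use xyz in \<open>simp_all add: mat_mult mat_add mult_closed algebra_simps sum.distrib\<close>)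
  show "z \<otimes> (x \<oplus> y) = z \<otimes> x \<oplus> z \<otimes> y"
    by (rule mat_eqI)
       (use xyz in \<open>simp_all add: mat_mult mat_add mult_closed algebra_simps sum.distrib\<close>)
qed (rule abelian_group_axioms)

sublocale ring R
  by (rule ring_R)

section \<open>Left ideals given by sets of columns\<close>

definition cols :: "'i set \<Rightarrow> 'a set"
  where "cols J = {x \<in> carrier R. \<forall>S. \<forall>T. T \<notin> J \<longrightarrow> mat x S T = 0}"

lemma cols_mono: "J \<subseteq> K \<Longrightarrow> cols J \<subseteq> cols K"
  by (auto simp: cols_def)

lemma cols_all: "cols X = carrier R"
  unfolding cols_def using mat_nonzeroD(2) by blast

lemma cols_closed: "x \<in> cols J \<Longrightarrow> x \<in> carrier R"
  by (simp add: cols_def)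

lemma cols_zero: "\<zero> \<in> cols J"
  by (simp add: cols_def mat_zero)

lemma cols_add: "x \<in> cols J \<Longrightarrow> y \<in> cols J \<Longrightarrow> x \<oplus> y \<in> cols J"
  by (simp add: cols_def mat_add)

lemma cols_mult: "a \<in> carrier R \<Longrightarrow> x \<in> cols J \<Longrightarrow> a \<otimes> x \<in> cols J"
  by (simp add: cols_def mat_mult mult_closed)

abbreviation cols_module :: "'i set \<Rightarrow> ('a, 'a) module"
  where "cols_module J \<equiv> restrict_module (regular_module R) (cols J)"

lemma cols_module_all: "cols_module X = regular_module R"
  by (simp add: cols_all regular_module_def)

text \<open>Left multiplication recombines rows and leaves every column in its place. The whole
  algebra, W^{n,k} and W_T are all of this form, for different sets of columns.\<close>

lemma submodule_cols: "submodule (cols J) R (regular_module R)"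
proof -
  interpret V: left_module R "regular_module R"
    by (rule left_module_regular[OF ring_axioms])
  show ?thesis
    by (rule V.submoduleI)
       (use cols_closed cols_zero cols_add cols_mult in \<open>auto simp: regular_module_def\<close>)
qed

lemma left_module_cols: "left_module R (cols_module J)"
  by (rule left_module_restrict[OF left_module_regular[OF ring_axioms] submodule_cols])

lemma submodule_cols_mono: "J \<subseteq> K \<Longrightarrow> submodule (cols J) R (cols_module K)"
proof -
  assume "J \<subseteq> K"
  interpret V: left_module R "cols_module K"
    by (rule left_module_cols)
  show ?thesis
    by (rule V.submoduleI)
       (use \<open>J \<subseteq> K\<close> cols_mono cols_zero cols_add cols_mult in \<open>auto simp: regular_module_def\<close>)
qed

lemma mat_finsum_cols:
  assumes "finite I" "f \<in> I \<rightarrow> cols J"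
  shows "mat (finsum (cols_module J) f I) S T = (\<Sum>i\<in>I. mat (f i) S T)"
  using assms
proof (induction I rule: finite_induct)
  case empty
  interpret V: left_module R "cols_module J"
    by (rule left_module_cols)
  show ?case
    using V.M.finsum_empty[of f] mat_zero by (simp del: V.M.finsum_empty) (simp add: regular_module_def)
next
  case (insert i I)
  interpret V: left_module R "cols_module J"
    by (rule left_module_cols)
  have "finsum (cols_module J) f (insert i I) = f i \<oplus> finsum (cols_module J) f I"
    using V.M.finsum_insert[of I i f] insert.hyps insert.prems
    by (simp add: Pi_iff) (simp add: regular_module_def)
  moreover have "finsum (cols_module J) f I \<in> cols J"
    using V.M.finsum_closed[of f I] insert.prems by (simp add: Pi_iff)
  ultimately show ?case
    using insert cols_closed[of _ J] by (simp add: mat_add Pi_iff)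
qed

text \<open>A matrix supported on \<open>K\<close> splits uniquely according to the partition of its
  columns. The ambient \<open>K\<close> is kept general so that one statement serves for the whole
  algebra and for each W^{n,k}.\<close>

theorem internal_direct_sum_cols:
  assumes "finite I" "disjoint_family_on J I" "(\<Union>i\<in>I. J i) = K"
  shows "internal_direct_sum R (cols_module K) I (\<lambda>i. cols (J i))"
  unfolding internal_direct_sum_def
proof (intro conjI ballI)
  show "submodule (cols (J i)) R (cols_module K)" if "i \<in> I" for i
    using that assms(3) by (intro submodule_cols_mono) auto
next
  fix x assume "x \<in> carrier (cols_module K)"
  then have x: "x \<in> carrier R" and xK: "\<And>S T. mat x S T \<noteq> 0 \<Longrightarrow> T \<in> K"
    by (auto simp: cols_def)
  have J_sub: "J i \<subseteq> K" if "i \<in> I" for i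
    using that assms(3) by blast
  have entry: "mat (finsum (cols_module K) f I) S T = mat (f i) S T"
    if f: "f \<in> (\<Pi>\<^sub>E i\<in>I. cols (J i))" and i: "i \<in> I" "T \<in> J i" for f i S T
  proof -
    have "f \<in> I \<rightarrow> cols K"
      using f cols_mono[OF J_sub] by (auto simp: PiE_iff subset_iff)
    then have "mat (finsum (cols_module K) f I) S T = (\<Sum>i'\<in>I. mat (f i') S T)"
      using assms(1) by (rule mat_finsum_cols[rotated])
    also have "\<dots> = (\<Sum>i'\<in>I. if i' = i then mat (f i) S T else 0)"
    proof (rule sum.cong[OF refl])
      fix i' assume i': "i' \<in> I"
      have "i' = i" if "mat (f i') S T \<noteq> 0"
        using that f i i' assms(2) by (fastforce simp: cols_def PiE_iff disjoint_family_on_def)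
      then show "mat (f i') S T = (if i' = i then mat (f i) S T else 0)"
        by auto
    qed
    finally show ?thesis
      using assms(1) i by simp
  qed
  \<comment> \<open>The i-th component of \<open>x\<close>: the columns in \<open>J i\<close> are
    kept and all others are erased, which leaves the block shape intact.\<close>
  define g where "g i = unmat (\<lambda>S T. if T \<in> J i then mat x S T else 0)" for i
  have block: "(\<lambda>S T. if T \<in> J i then mat x S T else 0) \<in> block_matrices X cls" for i
    using mat_nonzeroD[OF x] by (auto simp: block_matrices_def)
  have mat_g: "mat (g i) S T = (if T \<in> J i then mat x S T else 0)" for i S T
    by (simp add: g_def mat_unmat[OF block])
  have g: "restrict g I \<in> (\<Pi>\<^sub>E i\<in>I. cols (J i))"
    using unmat_closed[OF block] mat_g by (auto simp: cols_def g_def[symmetric] split: if_splits)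
  have closed: "finsum (cols_module K) f I \<in> carrier R" if "f \<in> (\<Pi>\<^sub>E i\<in>I. cols (J i))" for f
  proof -
    interpret V: left_module R "cols_module K"
      by (rule left_module_cols)
    have "f \<in> I \<rightarrow> carrier (cols_module K)"
      using that cols_mono[OF J_sub] by (auto simp: PiE_iff subset_iff)
    then show ?thesis
      using V.M.finsum_closed[of f I] cols_closed[of _ K] by simp
  qed
  have outside: "mat (finsum (cols_module K) f I) S T = 0"
    if f: "f \<in> (\<Pi>\<^sub>E i\<in>I. cols (J i))" and T: "T \<notin> K" for f S T
  proof -
    interpret V: left_module R "cols_module K"
      by (rule left_module_cols)
    have "f \<in> I \<rightarrow> carrier (cols_module K)"
      using f cols_mono[OF J_sub] by (auto simp: PiE_iff subset_iff)
    then show ?thesis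
      using V.M.finsum_closed[of f I] T by (auto simp: cols_def)
  qed
  show "\<exists>!f. f \<in> (\<Pi>\<^sub>E i\<in>I. cols (J i)) \<and> x = finsum (cols_module K) f I"
  proof (intro ex1I[of _ "restrict g I"] conjI)
    show "x = finsum (cols_module K) (restrict g I) I"
    proof (rule mat_eqI[OF x closed[OF g]])
      fix S T
      show "mat x S T = mat (finsum (cols_module K) (restrict g I) I) S T"
      proof (cases "T \<in> K")
        case True
        then obtain i where "i \<in> I" "T \<in> J i"
          using assms(3) by blast
        then show ?thesis
          using entry[OF g] mat_g by simp
      next
        case False
        then show ?thesis
          using outside[OF g] xK by metis
      qed
    qed
  next
    fix f assume f: "f \<in> (\<Pi>\<^sub>E i\<in>I. cols (J i)) \<and> x = finsum (cols_module K) f I"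
    show "f = restrict g I"
    proof (rule PiE_ext[OF conjunct1[OF f] g])
      fix i assume i: "i \<in> I"
      then have fi: "f i \<in> cols (J i)"
        using f by auto
      have "f i = g i"
      proof (rule mat_eqI)
        show "mat (f i) S T = mat (g i) S T" for S T
          using entry[OF conjunct1[OF f] i, of T S] f fi by (auto simp: mat_g cols_def)
      qed (use fi cols_closed unmat_closed[OF block] in \<open>auto simp: g_def\<close>)
      then show "f i = restrict g I i"
        using i by simp
    qed
  qed (rule g)
qed (use assms(1) left_module_cols in auto)

section \<open>Matrix units and irreducible columns\<close>

lemma col_eq:
  assumes "x \<in> cols {T}" "y \<in> cols {T}" "\<And>S. mat x S T = mat y S T"
  shows "x = y"
proof (rule mat_eqI)
  show "mat x S T' = mat y S T'" for S T'
    using assms by (cases "T' = T") (auto simp: cols_def)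
qed (use assms in \<open>auto simp: cols_def\<close>)

text \<open>The matrix unit at position (S, T). It has this meaning only for S and T of the same
  class, since otherwise the given function is not a block matrix and \<open>unmat\<close> says
  nothing about it.\<close>

definition unit_mat :: "'i \<Rightarrow> 'i \<Rightarrow> 'a"
  where "unit_mat S T = unmat (\<lambda>S' T'. if S' = S \<and> T' = T then 1 else 0)"

lemma
  assumes "S \<in> X" "T \<in> X" "cls S = cls T"
  shows unit_mat_closed: "unit_mat S T \<in> carrier R"
    and mat_unit_mat: "mat (unit_mat S T) S' T' = (if S' = S \<and> T' = T then 1 else 0)"
    and unit_mat_cols: "unit_mat S T \<in> cols {T}"
proof -
  have block: "(\<lambda>S' T'. if S' = S \<and> T' = T then 1 else 0 :: 'f) \<in> block_matrices X cls"
    using assms by (auto simp: block_matrices_def)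
  show closed: "unit_mat S T \<in> carrier R"
    unfolding unit_mat_def by (rule unmat_closed[OF block])
  have mat: "mat (unit_mat S T) S' T' = (if S' = S \<and> T' = T then 1 else 0)" for S' T'
    unfolding unit_mat_def by (simp add: mat_unmat[OF block])
  then show "mat (unit_mat S T) S' T' = (if S' = S \<and> T' = T then 1 else 0)" .
  show "unit_mat S T \<in> cols {T}"
    using closed mat by (auto simp: cols_def)
qed

lemma unit_mat_mult:
  assumes "S \<in> X" "T \<in> X" "U \<in> X" "cls S = cls T" "cls T = cls U"
  shows "unit_mat S T \<otimes> unit_mat T U = unit_mat S U"
proof (rule mat_eqI)
  fix S' U'
  have "mat (unit_mat S T \<otimes> unit_mat T U) S' U'
      = (\<Sum>V\<in>X. if V = T then if S' = S \<and> U' = U then 1 else 0 else 0)"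
    using assms
    by (auto simp: mat_mult unit_mat_closed mat_unit_mat intro!: sum.cong)
  also have "\<dots> = mat (unit_mat S U) S' U'"
    using assms finite_X by (simp add: mat_unit_mat)
  finally show "mat (unit_mat S T \<otimes> unit_mat T U) S' U' = mat (unit_mat S U) S' U'" .
qed (use assms in \<open>simp_all add: unit_mat_closed\<close>)

text \<open>A nonzero \<open>h\<close> in column T has a nonzero entry, say in row S. A matrix whose
  only nonzero column is column S then carries \<open>h\<close> to any prescribed element of column
  T, so a submodule containing \<open>h\<close> is the whole column.\<close>

theorem irreducible_col:
  assumes T: "T \<in> X"
  shows "irreducible_module R (cols_module {T})"
  unfolding irreducible_module_def
proof (intro conjI allI impI)
  have "unit_mat T T \<in> cols {T}" "unit_mat T T \<noteq> \<zero>"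
    using T unit_mat_cols mat_unit_mat[of T T T T] mat_zero[of T T] by auto
  then show "carrier (cols_module {T}) \<noteq> {\<zero>\<^bsub>cols_module {T}\<^esub>}"
    by (auto simp: regular_module_def)
next
  fix H assume "submodule H R (cols_module {T})"
  then interpret H: submodule H R "cols_module {T}" .
  have sub: "H \<subseteq> cols {T}"
    using H.subset by simp
  have mult: "a \<otimes> x \<in> H" if "a \<in> carrier R" "x \<in> H" for a x
    using H.smult_closed[OF that] by (simp add: regular_module_def)
  have zero: "\<zero> \<in> H"
    using H.one_closed by (simp add: regular_module_def)
  have "cols {T} \<subseteq> H" if "H \<noteq> {\<zero>}"
  proof
    from that zero obtain h where h: "h \<in> H" "h \<noteq> \<zero>"
      by blast
    then have hc: "h \<in> cols {T}" "h \<in> carrier R"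
      using sub cols_closed by auto
    obtain S where S: "mat h S T \<noteq> 0"
      using col_eq[OF hc(1) cols_zero] h(2) mat_zero by metis
    note SX = mat_nonzeroD[OF hc(2) S]
    fix g assume g: "g \<in> cols {T}"
    then have gc: "g \<in> carrier R"
      by (rule cols_closed)
    \<comment> \<open>Column S of \<open>F\<close> is \<open>g\<close> divided by the entry of
      \<open>h\<close> at S. It respects the blocks because rows where \<open>g\<close> is nonzero
      have the class of T, which is also the class of S.\<close>
    define F where "F S' U = (if U = S then mat g S' T / mat h S T else 0)" for S' U
    have F: "F \<in> block_matrices X cls"
      using SX mat_nonzeroD[OF gc] by (auto simp: block_matrices_def F_def)
    have "unmat F \<otimes> h = g"
    proof (rule col_eq)
      fix S'
      have "mat (unmat F \<otimes> h) S' T = (\<Sum>U\<in>X. if U = S then mat g S' T else 0)"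
        using S by (simp add: mat_mult unmat_closed F hc mat_unmat)
          (intro sum.cong; auto simp: F_def)
      then show "mat (unmat F \<otimes> h) S' T = mat g S' T"
        using SX finite_X by simp
    qed (use g hc F in \<open>auto intro: cols_mult unmat_closed\<close>)
    then show "g \<in> H"
      using mult[OF unmat_closed[OF F] h(1)] by simp
  qed
  then show "H = {\<zero>\<^bsub>cols_module {T}\<^esub>} \<or> H = carrier (cols_module {T})"
    using sub by (auto simp: regular_module_def)
qed (rule left_module_cols)

text \<open>Some E_TT x is nonzero, because these vectors sum to x. Acting on a suitable vector
  therefore gives a nonzero homomorphism from a column to \<open>N\<close>, and Schur's lemma
  applies. The function \<open>t\<close> selects one column per class, which allows the column to be
  replaced by the chosen representative of its class.\<close>

theorem irreducible_iso_col:
  assumes N: "irreducible_module R N"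
    and t: "\<And>T. T \<in> X \<Longrightarrow> t (cls T) \<in> X \<and> cls (t (cls T)) = cls T"
  shows "\<exists>T\<in>X. module_isomorphic R N (cols_module {t (cls T)})"
proof -
  interpret N: left_module R N
    using N by (simp add: irreducible_module_def)
  obtain x where x: "x \<in> carrier N" "x \<noteq> \<zero>\<^bsub>N\<^esub>"
    using N N.M.zero_closed unfolding irreducible_module_def by blast
  have "\<exists>T\<in>X. unit_mat T T \<odot>\<^bsub>N\<^esub> x \<noteq> \<zero>\<^bsub>N\<^esub>"
  proof (rule ccontr)
    assume *: "\<not> ?thesis"
    \<comment> \<open>Partial identity matrices: the sum of E_TT over T in \<open>F\<close>. They
      interpolate between 0 and the unit, so induction on \<open>F\<close> shows that the unit would
      kill x.\<close>
    define D where "D F = unmat (\<lambda>S T. if S = T \<and> S \<in> F then 1 else 0)" for F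
    have block: "(\<lambda>S T. if S = T \<and> S \<in> F then 1 else 0 :: 'f) \<in> block_matrices X cls"
      if "F \<subseteq> X" for F
      using that by (auto simp: block_matrices_def)
    have D: "D F \<in> carrier R" "mat (D F) S T = (if S = T \<and> S \<in> F then 1 else 0)"
      if "F \<subseteq> X" for F S T
      unfolding D_def using block[OF that] by (auto simp: unmat_closed mat_unmat)
    have "D F \<odot>\<^bsub>N\<^esub> x = \<zero>\<^bsub>N\<^esub>" if "finite F" "F \<subseteq> X" for F
      using that
    proof (induction F rule: finite_induct)
      case empty
      have "D {} = \<zero>"
        by (rule mat_eqI) (simp_all add: D mat_zero)
      then show ?case
        using N.smult_zero_left x by simp
    next
      case (insert T F)
      have "D (insert T F) = unit_mat T T \<oplus> D F"
        by (rule mat_eqI)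
           (use insert in \<open>auto simp: D mat_add unit_mat_closed mat_unit_mat\<close>)
      then show ?case
        using insert * x N.smult_l_distr[of "unit_mat T T" "D F" x]
        by (simp add: unit_mat_closed D)
    qed
    moreover have "D X = \<one>"
      by (rule mat_eqI) (simp_all add: D mat_one)
    ultimately show False
      using N.smult_one x finite_X by force
  qed
  then obtain T where T: "T \<in> X" "unit_mat T T \<odot>\<^bsub>N\<^esub> x \<noteq> \<zero>\<^bsub>N\<^esub>" ..
  define U where "U = t (cls T)"
  have U: "U \<in> X" "cls U = cls T"
    using t[OF T(1)] by (auto simp: U_def)
  \<comment> \<open>The vector is moved from T to the representative U. Nothing is lost, since E_TU
    lies in column U and sends \<open>y\<close> back to E_TT x, which is nonzero.\<close>
  define y where "y = unit_mat U T \<odot>\<^bsub>N\<^esub> x"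
  have y: "y \<in> carrier N"
    using U T x by (simp add: y_def N.smult_closed unit_mat_closed)
  have "unit_mat T U \<odot>\<^bsub>N\<^esub> y = unit_mat T T \<odot>\<^bsub>N\<^esub> x"
    using U T x by (simp add: y_def N.smult_assoc[symmetric] unit_mat_closed unit_mat_mult)
  then have "\<exists>a\<in>cols {U}. a \<odot>\<^bsub>N\<^esub> y \<noteq> \<zero>\<^bsub>N\<^esub>"
    using T U by (auto intro!: bexI[of _ "unit_mat T U"] unit_mat_cols)
  then have "module_isomorphic R N (cols_module {U})"
    using irreducible_module_iso[OF irreducible_col[OF U(1)] N, of "\<lambda>a. a \<odot>\<^bsub>N\<^esub> y"] y
    by (simp add: regular_module_def N.smult_closed N.smult_l_distr N.smult_assoc cols_closed)
  then show ?thesis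
    using T by (auto simp: U_def)
qed

text \<open>The index i stands for column \<open>b i\<close>, and the isomorphism relocates this
  column to position \<open>t i\<close>. This is compatible with left multiplication, which ignores
  the position of a column, and stays within the blocks as both positions have the same class.
  \<open>t\<close> may repeat values, which is how multiplicities arise.\<close>

theorem regular_module_iso_direct_sum:
  assumes I: "finite I" and b: "bij_betw b I X"
    and t: "\<And>i. i \<in> I \<Longrightarrow> t i \<in> X" "\<And>i. i \<in> I \<Longrightarrow> cls (t i) = cls (b i)"
  shows "module_isomorphic R (regular_module R) (direct_sum_module I (\<lambda>i. cols_module {t i}))"
proof -
  let ?D = "direct_sum_module I (\<lambda>i. cols_module {t i})"
  have carrier_D: "carrier ?D = (\<Pi>\<^sub>E i\<in>I. cols {t i})"
    using I by (simp add: direct_sum_module_def)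
  define p where "p x i = unmat (\<lambda>S T. if T = t i then mat x S (b i) else 0)" for x i
  have block: "(\<lambda>S T. if T = t i then mat x S (b i) else 0) \<in> block_matrices X cls"
    if "x \<in> carrier R" "i \<in> I" for x i
    using mat_nonzeroD[OF that(1)] t that(2) by (auto simp: block_matrices_def)
  have mat_p: "mat (p x i) S T = (if T = t i then mat x S (b i) else 0)"
    if "x \<in> carrier R" "i \<in> I" for x i S T
    using mat_unmat[OF block[OF that]] by (simp add: p_def)
  have p_cols: "p x i \<in> cols {t i}" if "x \<in> carrier R" "i \<in> I" for x i
    using unmat_closed[OF block[OF that]] mat_p[OF that]
    by (auto simp: cols_def p_def[symmetric] split: if_splits)
  define \<phi> where "\<phi> x = restrict (p x) I" for x
  have \<phi>_closed: "\<phi> x \<in> carrier ?D" if "x \<in> carrier R" for x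
    using p_cols that by (auto simp: \<phi>_def carrier_D)
  have p_add: "p (x \<oplus> y) i = p x i \<oplus> p y i"
    if "x \<in> carrier R" "y \<in> carrier R" "i \<in> I" for x y i
    by (rule col_eq[of _ "t i"])
       (use that p_cols[THEN cols_closed] in
         \<open>auto intro!: p_cols cols_add simp: mat_p mat_add\<close>)
  have p_mult: "p (a \<otimes> x) i = a \<otimes> p x i"
    if "a \<in> carrier R" "x \<in> carrier R" "i \<in> I" for a x i
    by (rule col_eq[of _ "t i"])
       (use that p_cols[THEN cols_closed] in
         \<open>auto intro!: p_cols cols_mult simp: mat_p mat_mult\<close>)
  have "inj_on \<phi> (carrier R)"
  proof (rule inj_onI, rule mat_eqI)
    fix x y S T
    assume xy: "x \<in> carrier R" "y \<in> carrier R" "\<phi> x = \<phi> y"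
    show "mat x S T = mat y S T"
    proof (cases "T \<in> X")
      case True
      then obtain i where i: "i \<in> I" "T = b i"
        using b by (auto simp: bij_betw_def)
      have "\<phi> x i = \<phi> y i"
        using xy(3) by simp
      then have "p x i = p y i"
        using i by (simp add: \<phi>_def)
      then show ?thesis
        using mat_p[of x i S "t i"] mat_p[of y i S "t i"] xy i by simp
    next
      case False
      then show ?thesis
        using mat_nonzeroD(2) xy by metis
    qed
  qed
  moreover have "f \<in> \<phi> ` carrier R" if f: "f \<in> carrier ?D" for f
  proof -
    define r where "r = inv_into I b"
    have r: "r T \<in> I" "b (r T) = T" if "T \<in> X" for T
      using b that by (auto simp: r_def bij_betw_def inv_into_into f_inv_into_f)
    have rb: "r (b i) = i" if "i \<in> I" for i
      using b that by (simp add: r_def bij_betw_def)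
    have fc: "f i \<in> cols {t i}" if "i \<in> I" for i
      using f that by (auto simp: carrier_D)
    \<comment> \<open>The preimage is assembled column by column: column T is taken from the
      component of \<open>f\<close> whose index corresponds to T under \<open>b\<close>, where it
      sits at position \<open>t (r T)\<close>.\<close>
    define F where "F S T = (if T \<in> X then mat (f (r T)) S (t (r T)) else 0)" for S T
    have F: "F \<in> block_matrices X cls"
      unfolding block_matrices_def
    proof (intro CollectI allI impI)
      fix S T assume "F S T \<noteq> 0"
      then have T: "T \<in> X" and nz: "mat (f (r T)) S (t (r T)) \<noteq> 0"
        by (auto simp: F_def split: if_splits)
      show "S \<in> X \<and> T \<in> X \<and> cls S = cls T"
        using mat_nonzeroD[OF cols_closed[OF fc[OF r(1)[OF T]]] nz] t(2)[OF r(1)[OF T]]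
          r(2)[OF T] T by simp
    qed
    have "\<phi> (unmat F) = f"
    proof (rule PiE_ext)
      show "f \<in> (\<Pi>\<^sub>E i\<in>I. cols {t i})" "\<phi> (unmat F) \<in> (\<Pi>\<^sub>E i\<in>I. cols {t i})"
        using f \<phi>_closed[OF unmat_closed[OF F]] by (simp_all add: carrier_D)
      fix i assume i: "i \<in> I"
      then have "b i \<in> X"
        using b by (auto simp: bij_betw_def)
      then have "p (unmat F) i = f i"
        by (intro col_eq[of _ "t i"] p_cols fc)
           (use i F in \<open>auto simp: mat_p unmat_closed mat_unmat F_def rb\<close>)
      then show "\<phi> (unmat F) i = f i"
        using i by (simp add: \<phi>_def)
    qed
    then show ?thesis
      using unmat_closed[OF F] by blast
  qed
  ultimately have "bij_betw \<phi> (carrier R) (carrier ?D)"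
    using \<phi>_closed by (auto simp: bij_betw_def)
  then have "\<phi> \<in> iso (add_monoid (regular_module R)) (add_monoid ?D)"
    using \<phi>_closed p_add
    by (auto simp: iso_def hom_def regular_module_def \<phi>_def direct_sum_module_def
        intro!: restrict_ext)
  moreover have "\<phi> (a \<odot>\<^bsub>regular_module R\<^esub> x) = a \<odot>\<^bsub>?D\<^esub> \<phi> x"
    if "a \<in> carrier R" "x \<in> carrier (regular_module R)" for a x
    using that p_mult
    by (auto simp: regular_module_def \<phi>_def direct_sum_module_def intro!: restrict_ext)
  moreover have "left_module R ?D"
    by (rule left_module_direct_sum[OF ring_axioms I left_module_cols])
  ultimately show ?thesis
    unfolding module_isomorphic_def using left_module_regular[OF ring_axioms] by blast
qed

end


subsection \<open>Ordered set partitions\<close>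

text \<open>Induction on the block sizes: the first block is any k-subset B of A, the others form an
  ordered partition of A - B, and (|A| choose k) * (|A| - k)! * k! = |A|!. The product form keeps
  division out of the induction. Disjointness is imposed along the list and not on the set of
  blocks, so empty blocks may repeat while nonempty ones may not.\<close>

lemma card_ordered_partitions:
  assumes "finite A" "sum_list ns = card A"
  shows "card {Ts. sorted_wrt disjnt Ts \<and> \<Union>(set Ts) = A \<and> map card Ts = ns}
      * prod_list (map fact ns) = fact (card A)"
  using assms
proof (induction ns arbitrary: A)
  case Nil
  then have "{Ts. sorted_wrt disjnt Ts \<and> \<Union>(set Ts) = A \<and> map card Ts = []} = {[]}"
    by auto
  then show ?case
    using Nil by simp
next
  case (Cons k ks)
  let ?P = "\<lambda>A ns. {Ts. sorted_wrt disjnt Ts \<and> \<Union>(set Ts) = A \<and> map card Ts = ns}"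
  let ?B = "{B. B \<subseteq> A \<and> card B = k}"
  have fin: "finite ?B"
    using Cons.prems(1) by simp
  have split: "?P A (k # ks) = (\<lambda>(B, Ts). B # Ts) ` (SIGMA B:?B. ?P (A - B) ks)"
  proof (intro equalityI subsetI)
    fix Ts assume Ts: "Ts \<in> ?P A (k # ks)"
    then obtain B Bs where [simp]: "Ts = B # Bs"
      by (cases Ts) auto
    have "B \<in> ?B" "Bs \<in> ?P (A - B) ks"
      using Ts by (auto simp: disjnt_def)
    then show "Ts \<in> (\<lambda>(B, Ts). B # Ts) ` (SIGMA B:?B. ?P (A - B) ks)"
      by (intro image_eqI[of _ _ "(B, Bs)"]) auto
  next
    fix Ts assume "Ts \<in> (\<lambda>(B, Ts). B # Ts) ` (SIGMA B:?B. ?P (A - B) ks)"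
    then obtain B Bs where Ts: "Ts = B # Bs" and B: "B \<in> ?B" and Bs: "Bs \<in> ?P (A - B) ks"
      by (elim imageE SigmaE) simp
    have "disjnt B C" if "C \<in> set Bs" for C
      using Bs that by (auto simp: disjnt_def)
    moreover have "\<Union>(set Ts) = A"
      using B Bs by (auto simp: Ts)
    ultimately show "Ts \<in> ?P A (k # ks)"
      using B Bs by (simp add: Ts)
  qed
  have card_P: "card (?P (A - B) ks) * prod_list (map fact ks) = fact (card A - k)"
    if "B \<in> ?B" for B
  proof -
    have "card (A - B) = card A - k"
      using that Cons.prems(1) finite_subset[of B A] by (auto simp: card_Diff_subset)
    then show ?thesis
      using Cons.IH[of "A - B"] Cons.prems by simp
  qed
  \<comment> \<open>An infinite set has cardinality 0, which the product formula rules out because a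
    factorial is nonzero.\<close>
  have fin_P: "finite (?P (A - B) ks)" if "B \<in> ?B" for B
    using card_P[OF that] by (metis (no_types, lifting) card.infinite fact_nonzero mult_zero_left)
  have "card (?P A (k # ks)) = card (SIGMA B:?B. ?P (A - B) ks)"
    unfolding split by (rule card_image) (auto simp: inj_on_def)
  also have "\<dots> = (\<Sum>B\<in>?B. card (?P (A - B) ks))"
    using fin fin_P by (intro card_SigmaI) auto
  finally have "card (?P A (k # ks)) * prod_list (map fact (k # ks))
      = (\<Sum>B\<in>?B. card (?P (A - B) ks) * prod_list (map fact ks)) * fact k"
    by (simp add: sum_distrib_left mult_ac)
  also have "\<dots> = (\<Sum>B\<in>?B. fact (card A - k)) * fact k"
    using card_P by simp
  also have "\<dots> = (card A choose k) * fact (card A - k) * fact k"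
    using n_subsets[OF Cons.prems(1), of k] by simp
  also have "\<dots> = fact (card A)"
    using binomial_fact_lemma[of k "card A"] Cons.prems(2) by (simp add: mult_ac)
  finally show ?case .
qed

corollary card_ordered_partitions_multinomial:
  assumes "finite A" "sum_list ns = card A"
  shows "card {Ts. sorted_wrt disjnt Ts \<and> \<Union>(set Ts) = A \<and> map card Ts = ns} = multinomial ns"
proof -
  have "prod_list (map fact ns) \<noteq> (0 :: nat)"
    by (simp add: prod_list_zero_iff image_iff)
  then show ?thesis
    unfolding multinomial_def assms(2) card_ordered_partitions[OF assms, symmetric]
    by (rule nonzero_mult_div_cancel_right[symmetric])
qed

lemma sum_list_card_partition:
  assumes "sorted_wrt disjnt Ts" "finite (\<Union>(set Ts))"
  shows "sum_list (map card Ts) = card (\<Union>(set Ts))"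
  using assms
proof (induction Ts)
  case (Cons T Ts)
  then have "T \<inter> \<Union>(set Ts) = {}"
    by (auto simp: disjnt_def)
  then show ?case
    using Cons by (simp add: card_Un_disjoint)
qed simp


subsection \<open>Ranks in finite sets of natural numbers\<close>

definition rank :: "nat set \<Rightarrow> nat \<Rightarrow> nat"
  where "rank A i = card {x \<in> A. x < i}"

lemma rank_less:
  assumes "finite A" "i \<in> A" "i < j"
  shows "rank A i < rank A j"
  unfolding rank_def by (rule psubset_card_mono) (use assms in auto)

lemma rank_inj:
  assumes "finite A" "i \<in> A" "j \<in> A" "rank A i = rank A j"
  shows "i = j"
  using assms rank_less[of A i j] rank_less[of A j i] by (cases i j rule: linorder_cases) auto

lemma rank_image:
  assumes "finite A"
  shows "rank A ` A = {..<card A}"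
proof (rule card_subset_eq)
  show "rank A ` A \<subseteq> {..<card A}"
    using assms by (auto simp: rank_def intro!: psubset_card_mono)
  have "inj_on (rank A) A"
    using rank_inj[OF assms] by (auto simp: inj_on_def)
  then show "card (rank A ` A) = card {..<card A}"
    by (simp add: card_image)
qed simp

text \<open>The ranks within either set fill the same initial segment of the natural
  numbers.\<close>

lemma ex_same_rank:
  assumes "finite A" "finite B" "card A = card B" "i \<in> A"
  shows "\<exists>j\<in>B. rank A i = rank B j"
  using rank_image[OF assms(1)] rank_image[OF assms(2)] assms(3,4) by (metis imageE imageI)


subsection \<open>Diagrams and their types\<close>

lemma Pnc_range:
  assumes "d \<in> Pnc n c" "(i, j, r) \<in> d"
  shows "i \<in> {1..n}" "j \<in> {1..n}" "r \<in> {1..c}"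
  using assms by (auto simp: Pnc_def)

lemma Pnc_top:
  assumes "d \<in> Pnc n c" "(i, j, r) \<in> d" "(i, j', r') \<in> d"
  shows "j = j'" "r = r'"
  using assms unfolding Pnc_def by blast+

lemma Pnc_bottom:
  assumes "d \<in> Pnc n c" "(i, j, r) \<in> d" "(i', j, r') \<in> d"
  shows "i = i'" "r = r'"
  using assms unfolding Pnc_def by blast+

lemma Pnc_order:
  assumes "d \<in> Pnc n c" "(i, j, r) \<in> d" "(i', j', r) \<in> d" "i < i'"
  shows "j < j'"
  using assms unfolding Pnc_def by blast

lemma Pnc_order_iff:
  assumes "d \<in> Pnc n c" "(i, j, r) \<in> d" "(i', j', r) \<in> d"
  shows "i < i' \<longleftrightarrow> j < j'"
  using Pnc_order[OF assms] Pnc_order[OF assms(1,3,2)] Pnc_top(1)[OF assms(1,2), of j' r] assms(3)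
  by (metis linorder_neqE_nat order_less_asym)

lemma finite_Pnc: "finite (Pnc n c)"
  by (rule finite_subset[of _ "Pow ({1..n} \<times> {1..n} \<times> {1..c})"]) (auto simp: Pnc_def)

lemma finite_diagram: "d \<in> Pnc n c \<Longrightarrow> finite d"
  by (rule finite_subset[of _ "{1..n} \<times> {1..n} \<times> {1..c}"]) (auto simp: Pnc_def)

text \<open>All conditions on a diagram speak of pairs of its edges at most, hence pass to subsets.
  This makes the order below a diagram Boolean.\<close>

lemma Pnc_subset:
  assumes d: "d \<in> Pnc n c" and sub: "e \<subseteq> d"
  shows "e \<in> Pnc n c"
  unfolding Pnc_def
proof (intro CollectI conjI allI impI)
  have "d \<subseteq> {1..n} \<times> {1..n} \<times> {1..c}"
    using d by (simp add: Pnc_def)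
  then show "e \<subseteq> {1..n} \<times> {1..n} \<times> {1..c}"
    using sub by (rule order_trans[rotated])
  fix i j r j' r' i'
  show "(j, r) = (j', r')" if "(i, j, r) \<in> e \<and> (i, j', r') \<in> e"
    using that sub Pnc_top[OF d, of i j r j' r'] by blast
  show "(i, r) = (i', r')" if "(i, j, r) \<in> e \<and> (i', j, r') \<in> e"
    using that sub Pnc_bottom[OF d, of i j r i' r'] by blast
  show "j < j'" if "(i, j, r) \<in> e \<and> (i', j', r) \<in> e \<and> i < i'"
    using that sub Pnc_order[OF d, of i j r i' j'] by blast
qed

lemma Pnc_mult:
  assumes d: "d \<in> Pnc n c" and e: "e \<in> Pnc n c"
  shows "diagram_mult d e \<in> Pnc n c"
  unfolding Pnc_def
proof (intro CollectI conjI allI impI)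
  have mem: "\<exists>m. (i, m, r) \<in> d \<and> (m, j, r) \<in> e" if "(i, j, r) \<in> diagram_mult d e" for i j r
    using that by (simp add: diagram_mult_def)
  show "diagram_mult d e \<subseteq> {1..n} \<times> {1..n} \<times> {1..c}"
  proof (rule subsetI, unfold split_paired_all)
    fix i j r assume "(i, j, r) \<in> diagram_mult d e"
    then obtain m where "(i, m, r) \<in> d" "(m, j, r) \<in> e"
      using mem by blast
    then show "(i, j, r) \<in> {1..n} \<times> {1..n} \<times> {1..c}"
      using Pnc_range(1,3)[OF d, of i m r] Pnc_range(2)[OF e, of m j r] by simp
  qed
  fix i j r j' r' i'
  show "(j, r) = (j', r')"
    if ij: "(i, j, r) \<in> diagram_mult d e \<and> (i, j', r') \<in> diagram_mult d e"
  proof -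
    obtain m m' where m: "(i, m, r) \<in> d" "(m, j, r) \<in> e" "(i, m', r') \<in> d" "(m', j', r') \<in> e"
      using mem ij by meson
    show ?thesis
      using Pnc_top[OF d m(1,3)] Pnc_top[OF e m(2), of j' r'] m(4) by simp
  qed
  show "(i, r) = (i', r')"
    if ij: "(i, j, r) \<in> diagram_mult d e \<and> (i', j, r') \<in> diagram_mult d e"
  proof -
    obtain m m' where m: "(i, m, r) \<in> d" "(m, j, r) \<in> e" "(i', m', r') \<in> d" "(m', j, r') \<in> e"
      using mem ij by meson
    show ?thesis
      using Pnc_bottom[OF e m(2,4)] Pnc_bottom[OF d m(1), of i' r'] m(3) by simp
  qed
  show "j < j'"
    if ij: "(i, j, r) \<in> diagram_mult d e \<and> (i', j', r) \<in> diagram_mult d e \<and> i < i'"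
  proof -
    obtain m m' where m: "(i, m, r) \<in> d" "(m, j, r) \<in> e" "(i', m', r) \<in> d" "(m', j', r) \<in> e"
      using mem ij by meson
    show ?thesis
      using Pnc_order[OF d m(1,3)] Pnc_order[OF e m(2,4)] ij by simp
  qed
qed

text \<open>Reflection in the horizontal axis. The type of the top row of \<open>d\<close> is
  expressed as \<open>beta n c (flip d)\<close>, so that facts about bottom rows also serve for top
  rows.\<close>

definition flip :: "diagram \<Rightarrow> diagram"
  where "flip d = {(j, i, r). (i, j, r) \<in> d}"

lemma mem_flip [simp]: "(j, i, r) \<in> flip d \<longleftrightarrow> (i, j, r) \<in> d"
  by (simp add: flip_def)

lemma Pnc_flip:
  assumes d: "d \<in> Pnc n c"
  shows "flip d \<in> Pnc n c"
  unfolding Pnc_def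
proof (intro CollectI conjI allI impI)
  show "flip d \<subseteq> {1..n} \<times> {1..n} \<times> {1..c}"
    using Pnc_range[OF d] by (auto simp: flip_def)
  fix i j r j' r' i'
  show "(j, r) = (j', r')" if "(i, j, r) \<in> flip d \<and> (i, j', r') \<in> flip d"
    using that Pnc_bottom[OF d] by auto
  show "(i, r) = (i', r')" if "(i, j, r) \<in> flip d \<and> (i', j, r') \<in> flip d"
    using that Pnc_top[OF d] by auto
  show "j < j'" if "(i, j, r) \<in> flip d \<and> (i', j', r) \<in> flip d \<and> i < i'"
    using that Pnc_order_iff[OF d, of j i r j' i'] by simp
qed

section \<open>Row types as ordered set partitions\<close>

lemma length_beta: "length (beta n c d) = c + 1"
  by (simp add: beta_def del: upt_Suc)

lemma beta_0: "beta n c d ! 0 = {j \<in> {1..n}. \<not> (\<exists>i r. (i, j, r) \<in> d)}"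
  by (simp add: beta_def)

lemma beta_nth:
  assumes "d \<in> Pnc n c" "r \<in> {1..c}"
  shows "beta n c d ! r = {j. \<exists>i. (i, j, r) \<in> d}"
proof -
  have "beta n c d ! r = {j \<in> {1..n}. \<exists>i. (i, j, r) \<in> d}"
    using assms(2) by (cases r) (simp_all add: beta_def del: upt_Suc)
  then show ?thesis
    using Pnc_range[OF assms(1)] by auto
qed

text \<open>The coloured entries suffice, since entry 0 is the complement of their union.\<close>

lemma beta_eqI:
  assumes d: "d \<in> Pnc n c" and e: "e \<in> Pnc n c"
    and eq: "\<And>r. r \<in> {1..c} \<Longrightarrow> beta n c d ! r = beta n c e ! r"
  shows "beta n c d = beta n c e"
proof -
  have iff: "(\<exists>i. (i, j, r) \<in> d) \<longleftrightarrow> (\<exists>i. (i, j, r) \<in> e)" for j r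
  proof (cases "r \<in> {1..c}")
    case True
    then show ?thesis
      using eq[OF True] beta_nth[OF d True] beta_nth[OF e True] by blast
  next
    case False
    then show ?thesis
      using Pnc_range(3)[OF d] Pnc_range(3)[OF e] by blast
  qed
  then have "(\<exists>i r. (i, j, r) \<in> d) \<longleftrightarrow> (\<exists>i r. (i, j, r) \<in> e)" for j
    by blast
  then show ?thesis
    unfolding beta_def using iff by simp
qed

lemma Xn_eqI:
  assumes "S \<in> Xn n c" "T \<in> Xn n c" "\<And>r. r \<in> {1..c} \<Longrightarrow> S ! r = T ! r"
  shows "S = T"
  using assms beta_eqI by (auto simp: Xn_def)

lemma beta_in_Xn: "d \<in> Pnc n c \<Longrightarrow> beta n c d \<in> Xn n c"
  by (simp add: Xn_def)

lemma Xn_nth_subset: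
  assumes "T \<in> Xn n c" "r \<in> {1..c}"
  shows "T ! r \<subseteq> {1..n}"
proof -
  obtain d where d: "d \<in> Pnc n c" "T = beta n c d"
    using assms(1) by (auto simp: Xn_def)
  show ?thesis
    using Pnc_range(2)[OF d(1)] by (auto simp: d(2) beta_nth[OF d(1) assms(2)])
qed

lemma Xn_nth_finite:
  assumes "T \<in> Xn n c" "r \<in> {1..c}"
  shows "finite (T ! r)"
  using Xn_nth_subset[OF assms] finite_subset by blast

lemma Xn_nth_disjoint:
  assumes "T \<in> Xn n c" "r \<in> {1..c}" "s \<in> {1..c}" "j \<in> T ! r" "j \<in> T ! s"
  shows "r = s"
  using assms Pnc_bottom(2) beta_nth by (auto simp: Xn_def)

lemma card_bottom:
  assumes d: "d \<in> Pnc n c"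
  shows "card {j. \<exists>i r. (i, j, r) \<in> d} = card d"
proof -
  have "{j. \<exists>i r. (i, j, r) \<in> d} = (\<lambda>(i, j, r). j) ` d"
    by force
  moreover have "inj_on (\<lambda>(i, j, r). j) d"
    using Pnc_bottom[OF d] by (fastforce simp: inj_on_def)
  ultimately show ?thesis
    by (simp add: card_image)
qed

lemma card_beta_0:
  assumes d: "d \<in> Pnc n c"
  shows "card (beta n c d ! 0) = n - card d"
proof -
  have "beta n c d ! 0 = {1..n} - {j. \<exists>i r. (i, j, r) \<in> d}"
    unfolding beta_0 by blast
  moreover have "{j. \<exists>i r. (i, j, r) \<in> d} \<subseteq> {1..n}"
    using Pnc_range(2)[OF d] by blast
  moreover from this have "finite {j. \<exists>i r. (i, j, r) \<in> d}"
    by (rule finite_subset) simp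
  ultimately show ?thesis
    using card_bottom[OF d] by (simp add: card_Diff_subset)
qed

lemma card_flip: "card (flip d) = card d"
proof -
  have "flip d = (\<lambda>(i, j, r). (j, i, r)) ` d"
    by (force simp: flip_def)
  moreover have "inj_on (\<lambda>(i, j, r). (j, i, r)) d"
    by (auto simp: inj_on_def)
  ultimately show ?thesis
    by (simp add: card_image)
qed

text \<open>Edges of one colour can be counted at either end, and each row has n minus the number of
  edges isolated vertices. This is the source of the block structure: only types with equal
  cardinalities can face each other in a diagram.\<close>

lemma card_beta_flip:
  assumes d: "d \<in> Pnc n c"
  shows "map card (beta n c (flip d)) = map card (beta n c d)"
proof (rule nth_equalityI)
  fix r assume "r < length (map card (beta n c (flip d)))"
  then have r: "r \<le> c"
    by (simp add: length_beta)
  have "card (beta n c (flip d) ! r) = card (beta n c d ! r)"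
  proof (cases "r = 0")
    case True
    then show ?thesis
      using card_beta_0[OF d] card_beta_0[OF Pnc_flip[OF d]] by (simp add: card_flip)
  next
    case False
    let ?E = "{(i, j). (i, j, r) \<in> d}"
    have r: "r \<in> {1..c}"
      using False r by auto
    have "beta n c (flip d) ! r = fst ` ?E" "beta n c d ! r = snd ` ?E"
      unfolding beta_nth[OF d r] beta_nth[OF Pnc_flip[OF d] r] by (auto simp: image_iff)
    moreover have "inj_on fst ?E"
      using Pnc_top(1)[OF d] by (auto simp: inj_on_def)
    moreover have "inj_on snd ?E"
      using Pnc_bottom(1)[OF d] by (auto simp: inj_on_def)
    ultimately show ?thesis
      by (simp add: card_image)
  qed
  then show "map card (beta n c (flip d)) ! r = map card (beta n c d) ! r"
    using r by (simp add: length_beta)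
qed (simp add: length_beta)

lemma sum_card_beta:
  assumes d: "d \<in> Pnc n c"
  shows "(\<Sum>r = 1..c. card (beta n c d ! r)) = card d"
proof -
  have fin: "finite (beta n c d ! r)" if "r \<in> {1..c}" for r
    using Xn_nth_finite[OF beta_in_Xn[OF d] that] .
  have "(\<Sum>r = 1..c. card (beta n c d ! r)) = card (SIGMA r:{1..c}. beta n c d ! r)"
    using fin by simp
  also have "(SIGMA r:{1..c}. beta n c d ! r) = (SIGMA r:{1..c}. {j. \<exists>i. (i, j, r) \<in> d})"
    using beta_nth[OF d] by (intro Sigma_cong) auto
  also have "\<dots> = (\<lambda>e. (snd (snd e), fst (snd e))) ` d"
    using Pnc_range(3)[OF d] by (auto simp: image_iff Bex_def)
  also have "card \<dots> = card d"
    by (rule card_image) (use Pnc_bottom(1)[OF d] in \<open>auto simp: inj_on_def\<close>)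
  finally show ?thesis .
qed

text \<open>Makes the counting of ordered set partitions available for types. For the converse
  inclusion, a partition is the bottom row of the diagram of vertical edges coloured by it, where no
  two edges cross.\<close>

lemma Xn_partition:
  "Xn n c = {T. length T = c + 1 \<and> sorted_wrt disjnt T \<and> \<Union>(set T) = {1..n}}"
proof (intro equalityI subsetI)
  fix T assume "T \<in> Xn n c"
  then obtain d where d: "d \<in> Pnc n c" and T: "T = beta n c d"
    by (auto simp: Xn_def)
  have "sorted_wrt disjnt T"
    unfolding sorted_wrt_iff_nth_less
  proof (intro allI impI)
    fix r s assume "r < s" "s < length T"
    then have s: "s \<in> {1..c}"
      by (auto simp: T length_beta)
    show "disjnt (T ! r) (T ! s)"
    proof (cases "r = 0")
      case True
      then show ?thesis
        by (auto simp: T beta_0 beta_nth[OF d s] disjnt_def simp del: One_nat_def)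
    next
      case False
      then have "r \<in> {1..c}"
        using s \<open>r < s\<close> by auto
      then show ?thesis
        using \<open>r < s\<close> Xn_nth_disjoint[OF \<open>T \<in> Xn n c\<close> _ s] by (fastforce simp: disjnt_def)
    qed
  qed
  moreover have "\<Union>(set T) = {1..n}"
  proof (intro equalityI subsetI)
    have T: "set T = insert {j \<in> {1..n}. \<not> (\<exists>i r. (i, j, r) \<in> d)}
        ((\<lambda>r. {j \<in> {1..n}. \<exists>i. (i, j, r) \<in> d}) ` {1..c})"
      unfolding T beta_def by (simp del: upt_Suc add: atLeastLessThanSuc_atLeastAtMost)
    show "j \<in> {1..n}" if "j \<in> \<Union>(set T)" for j
      using that unfolding T by auto
    show "j \<in> \<Union>(set T)" if "j \<in> {1..n}" for j
    proof (cases "\<exists>i r. (i, j, r) \<in> d")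
      case True
      then obtain i r where "(i, j, r) \<in> d"
        by blast
      then show ?thesis
        using that Pnc_range(3)[OF d, of i j r] unfolding T by auto
    next
      case False
      then show ?thesis
        using that unfolding T by auto
    qed
  qed
  ultimately show "T \<in> {T. length T = c + 1 \<and> sorted_wrt disjnt T \<and> \<Union>(set T) = {1..n}}"
    by (simp add: T length_beta)
next
  fix T assume "T \<in> {T. length T = c + 1 \<and> sorted_wrt disjnt T \<and> \<Union>(set T) = {1..n}}"
  then have len: "length T = c + 1" and union: "\<Union>(set T) = {1..n}"
    and "sorted_wrt disjnt T"
    by auto
  then have disj: "r = s" if "j \<in> T ! r" "j \<in> T ! s" "r \<le> c" "s \<le> c" for j r s
    using that unfolding sorted_wrt_iff_nth_less
    by (metis Suc_eq_plus1 disjnt_iff le_imp_less_Suc linorder_neqE_nat)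
  have sub: "T ! r \<subseteq> {1..n}" if "r \<le> c" for r
    using union nth_mem[of r T] len that by auto
  have cover: "\<exists>r\<le>c. j \<in> T ! r" if "j \<in> {1..n}" for j
    using that len unfolding union[symmetric] by (auto simp: in_set_conv_nth less_Suc_eq_le)
  define d where "d = {(i, j, r). i = j \<and> r \<in> {1..c} \<and> j \<in> T ! r}"
  have d: "d \<in> Pnc n c"
    unfolding Pnc_def d_def using sub disj by auto
  have "beta n c d = T"
  proof (rule nth_equalityI)
    fix r assume "r < length (beta n c d)"
    then have r: "r \<le> c"
      by (simp add: length_beta)
    show "beta n c d ! r = T ! r"
    proof (cases "r = 0")
      case True
      have "j \<in> T ! 0 \<longleftrightarrow> j \<in> {1..n} \<and> (\<forall>r\<in>{1..c}. j \<notin> T ! r)" for j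
      proof
        assume j: "j \<in> T ! 0"
        then show "j \<in> {1..n} \<and> (\<forall>r\<in>{1..c}. j \<notin> T ! r)"
          using sub[of 0] disj[OF j] by fastforce
      next
        assume j: "j \<in> {1..n} \<and> (\<forall>r\<in>{1..c}. j \<notin> T ! r)"
        then obtain s where "s \<le> c" "j \<in> T ! s"
          using cover by blast
        then show "j \<in> T ! 0"
          using j by (cases "s = 0") auto
      qed
      then have "beta n c d ! 0 = T ! 0"
        unfolding beta_0 d_def by blast
      then show ?thesis
        using True by simp
    next
      case False
      then show ?thesis
        using r by (subst beta_nth[OF d]) (auto simp: d_def)
    qed
  qed (simp add: length_beta len)
  then show "T \<in> Xn n c"
    using d by (auto simp: Xn_def)
qed

lemma finite_Xn: "finite (Xn n c)"
  by (simp add: Xn_def finite_Pnc)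

lemma map_card_Xn: "T \<in> Xn n c \<Longrightarrow> map card T \<in> weak_compositions n c"
  using sum_list_card_partition[of T] by (simp add: Xn_partition weak_compositions_def)

lemma card_Xn_type:
  assumes "ns \<in> weak_compositions n c"
  shows "card {T \<in> Xn n c. map card T = ns} = multinomial ns"
proof -
  have "{T \<in> Xn n c. map card T = ns}
      = {T. sorted_wrt disjnt T \<and> \<Union>(set T) = {1..n} \<and> map card T = ns}"
    using assms by (auto simp: Xn_partition weak_compositions_def)
  then show ?thesis
    using card_ordered_partitions_multinomial[of "{1..n}" ns] assms
    by (simp add: weak_compositions_def)
qed


subsection \<open>Diagrams are determined by their types\<close>

text \<open>The diagram with top type S and bottom type T, in the case that their cardinalities
  agree. Otherwise it is still a diagram, but vertices whose rank has no counterpart stay isolated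
  and the types are not S and T.\<close>

definition link :: "nat \<Rightarrow> nat set list \<Rightarrow> nat set list \<Rightarrow> diagram"
  where "link c S T =
    {(i, j, r). r \<in> {1..c} \<and> i \<in> S ! r \<and> j \<in> T ! r \<and> rank (S ! r) i = rank (T ! r) j}"

lemma mem_link:
  "(i, j, r) \<in> link c S T \<longleftrightarrow>
    r \<in> {1..c} \<and> i \<in> S ! r \<and> j \<in> T ! r \<and> rank (S ! r) i = rank (T ! r) j"
  by (simp add: link_def)

lemma link_Pnc:
  assumes S: "S \<in> Xn n c" and T: "T \<in> Xn n c"
  shows "link c S T \<in> Pnc n c"
  unfolding Pnc_def
proof (intro CollectI conjI allI impI)
  show "link c S T \<subseteq> {1..n} \<times> {1..n} \<times> {1..c}"
    using Xn_nth_subset[OF S] Xn_nth_subset[OF T] unfolding link_def by blast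
  fix i j r j' r' i'
  show "(j, r) = (j', r')" if "(i, j, r) \<in> link c S T \<and> (i, j', r') \<in> link c S T"
    using that Xn_nth_disjoint[OF S, of r r' i] rank_inj[OF Xn_nth_finite[OF T]]
    unfolding mem_link by metis
  show "(i, r) = (i', r')" if "(i, j, r) \<in> link c S T \<and> (i', j, r') \<in> link c S T"
    using that Xn_nth_disjoint[OF T, of r r' j] rank_inj[OF Xn_nth_finite[OF S]]
    unfolding mem_link by metis
  show "j < j'" if "(i, j, r) \<in> link c S T \<and> (i', j', r) \<in> link c S T \<and> i < i'"
    using that rank_less[OF Xn_nth_finite[OF S], of r i i']
      rank_less[OF Xn_nth_finite[OF T], of r j' j]
    unfolding mem_link by (metis linorder_neqE_nat order_less_asym order_less_irrefl)
qed

lemma same_type_card: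
  assumes "S \<in> Xn n c" "T \<in> Xn n c" "map card S = map card T" "r \<in> {1..c}"
  shows "card (S ! r) = card (T ! r)"
proof -
  have "r < length S" "r < length T"
    using assms by (auto simp: Xn_partition)
  then show ?thesis
    using assms(3) by (metis nth_map)
qed

lemma link_ex_bottom:
  assumes S: "S \<in> Xn n c" and T: "T \<in> Xn n c" and "map card S = map card T"
    and "r \<in> {1..c}" "i \<in> S ! r"
  shows "\<exists>j\<in>T ! r. (i, j, r) \<in> link c S T"
  using ex_same_rank[OF Xn_nth_finite[OF S] Xn_nth_finite[OF T] same_type_card[OF S T]] assms
  by (fastforce simp: mem_link)

lemma link_ex_top:
  assumes S: "S \<in> Xn n c" and T: "T \<in> Xn n c" and eq: "map card S = map card T"
    and r: "r \<in> {1..c}" "j \<in> T ! r"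
  shows "\<exists>i\<in>S ! r. (i, j, r) \<in> link c S T"
proof -
  obtain i where "i \<in> S ! r" "(j, i, r) \<in> link c T S"
    using link_ex_bottom[OF T S eq[symmetric] r] by blast
  then show ?thesis
    by (auto simp: mem_link)
qed

lemma beta_link:
  assumes S: "S \<in> Xn n c" and T: "T \<in> Xn n c" and eq: "map card S = map card T"
  shows "beta n c (link c S T) = T"
proof (rule Xn_eqI[of _ n c])
  show "beta n c (link c S T) \<in> Xn n c"
    using link_Pnc[OF S T] by (auto simp: Xn_def)
  fix r assume r: "r \<in> {1..c}"
  show "beta n c (link c S T) ! r = T ! r"
    unfolding beta_nth[OF link_Pnc[OF S T] r] using link_ex_top[OF S T eq r]
    by (auto simp: mem_link)
qed (rule T)

text \<open>Edges of one colour do not cross, so those starting to the left of i are exactly those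
  ending to the left of j. Counting this set of edges by top and by bottom vertices gives the two
  ranks.\<close>

lemma Pnc_rank:
  assumes d: "d \<in> Pnc n c" and e: "(i, j, r) \<in> d"
  shows "rank (beta n c (flip d) ! r) i = rank (beta n c d ! r) j"
proof -
  have r: "r \<in> {1..c}"
    using Pnc_range(3)[OF d e] .
  let ?E = "{(x, y). (x, y, r) \<in> d \<and> x < i}"
  have "{x \<in> beta n c (flip d) ! r. x < i} = fst ` ?E"
    unfolding beta_nth[OF Pnc_flip[OF d] r] by (auto simp: image_iff)
  moreover have "{x \<in> beta n c d ! r. x < j} = snd ` ?E"
    unfolding beta_nth[OF d r] using Pnc_order_iff[OF d _ e] by (auto simp: image_iff) blast
  moreover have "inj_on fst ?E"
    using Pnc_top(1)[OF d] by (auto simp: inj_on_def)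
  moreover have "inj_on snd ?E"
    using Pnc_bottom(1)[OF d] by (auto simp: inj_on_def)
  ultimately show ?thesis
    by (simp add: rank_def card_image)
qed

text \<open>Together with \<open>beta_link\<close> this identifies diagrams with pairs of types of
  equal cardinalities. The inclusion into \<open>d\<close> holds since the edge of \<open>d\<close>
  at i ends at a vertex with the rank of j, and ranks are injective.\<close>

lemma link_beta:
  assumes d: "d \<in> Pnc n c"
  shows "link c (beta n c (flip d)) (beta n c d) = d"
proof -
  have "(i, j, r) \<in> d" if e: "(i, j, r) \<in> link c (beta n c (flip d)) (beta n c d)" for i j r
  proof -
    have r: "r \<in> {1..c}" and i: "i \<in> beta n c (flip d) ! r" and j: "j \<in> beta n c d ! r"
      and eq: "rank (beta n c (flip d) ! r) i = rank (beta n c d ! r) j"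
      using e by (simp_all add: mem_link)
    obtain j' where j': "(i, j', r) \<in> d"
      using i beta_nth[OF Pnc_flip[OF d] r] by auto
    have "j' \<in> beta n c d ! r"
      using j' beta_nth[OF d r] by auto
    moreover have "rank (beta n c d ! r) j' = rank (beta n c d ! r) j"
      using Pnc_rank[OF d j'] eq by simp
    ultimately show ?thesis
      using rank_inj[OF Xn_nth_finite[OF beta_in_Xn[OF d] r]] j j' by metis
  qed
  moreover have "(i, j, r) \<in> link c (beta n c (flip d)) (beta n c d)" if e: "(i, j, r) \<in> d" for i j r
    using Pnc_range(3)[OF d e] Pnc_rank[OF d e] beta_nth[OF d, of r] beta_nth[OF Pnc_flip[OF d], of r] e
    by (auto simp: mem_link)
  ultimately show ?thesis
    by auto
qed

section \<open>Factoring a link through a product\<close>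

lemma link_subset_mult:
  assumes S: "S \<in> Xn n c" and T: "T \<in> Xn n c" and U: "U \<in> Xn n c"
    and eq: "map card S = map card U"
    and d: "link c S U \<subseteq> d" and e: "link c U T \<subseteq> e"
  shows "link c S T \<subseteq> diagram_mult d e"
proof -
  have "(i, j, r) \<in> diagram_mult d e" if ij: "(i, j, r) \<in> link c S T" for i j r
  proof -
    have r: "r \<in> {1..c}" "i \<in> S ! r"
      using ij by (auto simp: mem_link)
    obtain m where m: "m \<in> U ! r" "(i, m, r) \<in> link c S U"
      using link_ex_bottom[OF S U eq r] by blast
    then have "(m, j, r) \<in> link c U T"
      using ij by (auto simp: mem_link)
    then show ?thesis
      using m d e by (auto simp: diagram_mult_def)
  qed
  then show ?thesis
    by auto
qed

text \<open>U consists of the middle vertices, sorted by colour, that are reached from S along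
  \<open>d\<close>. Restricting \<open>d\<close> to edges starting in S, and \<open>e\<close> to
  edges starting in U, gives diagrams whose row types turn out to be S, U and U, T; a diagram is
  determined by its types, so they are the required links.\<close>

lemma mult_ex_link:
  assumes S: "S \<in> Xn n c" and T: "T \<in> Xn n c" and eq: "map card S = map card T"
    and d: "d \<in> Pnc n c" and e: "e \<in> Pnc n c" and sub: "link c S T \<subseteq> diagram_mult d e"
  shows "\<exists>U\<in>Xn n c. map card S = map card U \<and> link c S U \<subseteq> d \<and> link c U T \<subseteq> e"
proof -
  define d' where "d' = {(i, m, r). (i, m, r) \<in> d \<and> i \<in> S ! r}"
  have d': "d' \<in> Pnc n c" "d' \<subseteq> d"
    using Pnc_subset[OF d, of d'] by (auto simp: d'_def)
  define U where "U = beta n c d'"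
  define e' where "e' = {(m, j, r). (m, j, r) \<in> e \<and> m \<in> U ! r}"
  have e': "e' \<in> Pnc n c" "e' \<subseteq> e"
    using Pnc_subset[OF e, of e'] by (auto simp: e'_def)
  have U: "U \<in> Xn n c"
    by (simp add: U_def beta_in_Xn d')
  have U_nth: "U ! r = {m. \<exists>i\<in>S ! r. (i, m, r) \<in> d}" if "r \<in> {1..c}" for r
    unfolding U_def beta_nth[OF d'(1) that] by (auto simp: d'_def)
  have path: "\<exists>m j. (i, m, r) \<in> d \<and> (m, j, r) \<in> e \<and> j \<in> T ! r" if "r \<in> {1..c}" "i \<in> S ! r" for i r
    using link_ex_bottom[OF S T eq that] sub by (fastforce simp: diagram_mult_def)
  have top_d': "beta n c (flip d') = S"
  proof (rule Xn_eqI[of _ n c])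
    fix r assume r: "r \<in> {1..c}"
    show "beta n c (flip d') ! r = S ! r"
      unfolding beta_nth[OF Pnc_flip[OF d'(1)] r] using path[OF r] by (auto simp: d'_def)
  qed (simp_all add: S beta_in_Xn Pnc_flip d')
  have top_e': "beta n c (flip e') = U"
  proof (rule Xn_eqI[of _ n c])
    fix r assume r: "r \<in> {1..c}"
    have "\<exists>j. (m, j, r) \<in> e" if "m \<in> U ! r" for m
      using that path[OF r] Pnc_top(1)[OF d] unfolding U_nth[OF r] by blast
    then show "beta n c (flip e') ! r = U ! r"
      unfolding beta_nth[OF Pnc_flip[OF e'(1)] r] by (auto simp: e'_def)
  qed (simp_all add: U beta_in_Xn Pnc_flip e')
  have bottom_e': "beta n c e' = T"
  proof (rule Xn_eqI[of _ n c])
    fix r assume r: "r \<in> {1..c}"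
    \<comment> \<open>The vertex m is reached from some i in S, and i starts a path that ends in T.
      Each vertex has at most one edge on each side, so this path runs through m and ends at
      j.\<close>
    have "j \<in> T ! r" if mj: "(m, j, r) \<in> e" "m \<in> U ! r" for m j
    proof -
      obtain i where "i \<in> S ! r" "(i, m, r) \<in> d"
        using mj(2) U_nth[OF r] by auto
      then show ?thesis
        using path[OF r, of i] Pnc_top(1)[OF d] Pnc_top(1)[OF e] mj(1) by metis
    qed
    moreover have "\<exists>m\<in>U ! r. (m, j, r) \<in> e" if "j \<in> T ! r" for j
    proof -
      obtain i where i: "i \<in> S ! r" "(i, j, r) \<in> link c S T"
        using link_ex_top[OF S T eq r \<open>j \<in> T ! r\<close>] by blast
      then have "(i, j, r) \<in> diagram_mult d e"
        using sub by blast
      then obtain m where "(i, m, r) \<in> d" "(m, j, r) \<in> e"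
        by (auto simp: diagram_mult_def)
      then show ?thesis
        using i(1) U_nth[OF r] by blast
    qed
    ultimately show "beta n c e' ! r = T ! r"
      unfolding beta_nth[OF e'(1) r] by (auto simp: e'_def) blast
  qed (simp_all add: T beta_in_Xn e')
  have "link c S U = d'" "link c U T = e'"
    using link_beta[OF d'(1)] link_beta[OF e'(1)] top_d' top_e' bottom_e' by (simp_all add: U_def)
  moreover have "map card S = map card U"
    using card_beta_flip[OF d'(1)] top_d' by (simp add: U_def)
  ultimately show ?thesis
    using U d' e' by blast
qed

text \<open>Since \<open>d\<close> has at most one edge at each top vertex, U is forced to be the
  image of S under \<open>d\<close>, colour by colour. This is why each pair of diagrams contributes
  to at most one term of the matrix product.\<close>

lemma link_subset_unique:
  assumes S: "S \<in> Xn n c" and U: "U \<in> Xn n c" "map card S = map card U" "link c S U \<subseteq> d"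
    and U': "U' \<in> Xn n c" "map card S = map card U'" "link c S U' \<subseteq> d" and d: "d \<in> Pnc n c"
  shows "U = U'"
proof (rule Xn_eqI[of _ n c])
  have nth: "U ! r = {m. \<exists>i\<in>S ! r. (i, m, r) \<in> d}"
    if r: "r \<in> {1..c}" and U: "U \<in> Xn n c" "map card S = map card U" "link c S U \<subseteq> d" for U r
  proof (intro equalityI subsetI)
    fix m assume "m \<in> U ! r"
    then show "m \<in> {m. \<exists>i\<in>S ! r. (i, m, r) \<in> d}"
      using link_ex_top[OF S U(1,2) r] U(3) by blast
  next
    fix m assume "m \<in> {m. \<exists>i\<in>S ! r. (i, m, r) \<in> d}"
    then obtain i where "i \<in> S ! r" "(i, m, r) \<in> d"
      by blast
    then show "m \<in> U ! r"
      using link_ex_bottom[OF S U(1,2) r] U(3) Pnc_top(1)[OF d] by blast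
  qed
  show "U ! r = U' ! r" if "r \<in> {1..c}" for r
    using nth[OF that U] nth[OF that U'] by simp
qed (use U U' in auto)


subsection \<open>Inversion over the inclusion order of diagrams\<close>

text \<open>The zeta transform for the inclusion order. The condition stands inside the sum, over a
  fixed index set, so that sums can be added termwise and interchanged.\<close>

definition up_sum :: "nat \<Rightarrow> nat \<Rightarrow> (diagram \<Rightarrow> complex) \<Rightarrow> diagram \<Rightarrow> complex"
  where "up_sum n c f a = (\<Sum>d\<in>Pnc n c. if a \<subseteq> d then f d else 0)"

lemma up_sum_add: "up_sum n c (\<lambda>d. f d + g d) a = up_sum n c f a + up_sum n c g a"
  by (simp add: up_sum_def sum.distrib[symmetric] if_distrib cong: if_cong)

lemma up_sum_scale: "up_sum n c (\<lambda>d. z * f d) a = z * up_sum n c f a"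
  by (simp add: up_sum_def sum_distrib_left if_distrib cong: if_cong)

lemma up_sum_sum: "up_sum n c (\<lambda>d. \<Sum>x\<in>A. f x d) a = (\<Sum>x\<in>A. up_sum n c (f x) a)"
proof -
  have "up_sum n c (\<lambda>d. \<Sum>x\<in>A. f x d) a
      = (\<Sum>d\<in>Pnc n c. \<Sum>x\<in>A. if a \<subseteq> d then f x d else 0)"
    unfolding up_sum_def by (rule sum.cong) auto
  then show ?thesis
    unfolding up_sum_def by (subst sum.swap) simp
qed

lemma up_sum_nonzeroD:
  assumes "up_sum n c f a \<noteq> 0"
  shows "a \<in> Pnc n c"
proof (rule ccontr)
  assume "a \<notin> Pnc n c"
  then have "\<not> a \<subseteq> d" if "d \<in> Pnc n c" for d
    using Pnc_subset[OF that] by blast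
  then show False
    using assms by (simp add: up_sum_def)
qed

text \<open>The transform is unitriangular: at an inclusion-maximal diagram where f and g differ,
  all other terms of the two sums cancel.\<close>

lemma up_sum_inject:
  assumes f: "f \<in> CP_carrier n c" and g: "g \<in> CP_carrier n c"
    and eq: "\<And>a. a \<in> Pnc n c \<Longrightarrow> up_sum n c f a = up_sum n c g a"
  shows "f = g"
proof (rule ccontr)
  assume "f \<noteq> g"
  let ?D = "{d \<in> Pnc n c. f d \<noteq> g d}"
  have "?D \<noteq> {}"
  proof
    assume "?D = {}"
    then have "f d = g d" for d
      using f g by (cases "d \<in> Pnc n c") (auto simp: CP_carrier_def)
    then show False
      using \<open>f \<noteq> g\<close> by auto
  qed
  moreover have "finite ?D"
    using finite_Pnc by simp
  ultimately have "\<exists>m\<in>?D. \<forall>d\<in>?D. m \<subseteq> d \<longrightarrow> m = d"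
    by (intro finite_has_maximal)
  then obtain m where m: "m \<in> ?D" and max: "\<And>d. d \<in> ?D \<Longrightarrow> m \<subseteq> d \<Longrightarrow> d = m"
    by blast
  have "0 = up_sum n c f m - up_sum n c g m"
    using eq m by simp
  also have "\<dots> = (\<Sum>d\<in>Pnc n c. if d = m then f m - g m else 0)"
    unfolding up_sum_def sum_subtractf[symmetric]
  proof (rule sum.cong[OF refl])
    fix d assume "d \<in> Pnc n c"
    then show "(if m \<subseteq> d then f d else 0) - (if m \<subseteq> d then g d else 0)
        = (if d = m then f m - g m else 0)"
      using max[of d] by auto
  qed
  also have "\<dots> = f m - g m"
    using m finite_Pnc by simp
  finally show False
    using m by simp
qed

lemma xd_carrier: "xd n c a \<in> CP_carrier n c"
  by (auto simp: CP_carrier_def xd_def basis_vector_def intro!: sum.neutral)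

lemma xd_apply:
  "xd n c a e = (if e \<in> Pnc n c \<and> e \<subseteq> a then (-1) ^ (card a - card e) else 0)"
proof -
  have "xd n c a e = (\<Sum>d\<in>{d \<in> Pnc n c. d \<subseteq> a}. if d = e then (-1) ^ (card a - card e) else 0)"
    unfolding xd_def basis_vector_def by (rule sum.cong) auto
  then show ?thesis
    using finite_Pnc by simp
qed

text \<open>The vectors x_a form the dual basis of the functionals \<open>up_sum\<close>: the sum
  runs over the Boolean interval from b to a, where the signs cancel unless the interval is a single
  point.\<close>

lemma up_sum_xd:
  assumes a: "a \<in> Pnc n c"
  shows "up_sum n c (xd n c a) b = (if b = a then 1 else 0)"
proof -
  let ?I = "{d. b \<subseteq> d \<and> d \<subseteq> a}"
  have fin: "finite a"
    using finite_diagram[OF a] .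
  have "up_sum n c (xd n c a) b
      = (\<Sum>d\<in>Pnc n c. if d \<in> ?I then (-1) ^ (card a - card d) else 0)"
    unfolding up_sum_def xd_apply by (rule sum.cong) auto
  also have "\<dots> = (\<Sum>d\<in>Pnc n c \<inter> ?I. (-1) ^ (card a - card d))"
    using finite_Pnc by (simp add: sum.inter_restrict)
  also have "Pnc n c \<inter> ?I = ?I"
    using Pnc_subset[OF a] by auto
  finally have sum: "up_sum n c (xd n c a) b = (\<Sum>d\<in>?I. (-1) ^ (card a - card d))" .
  consider "b = a" | "b \<subset> a" | "\<not> b \<subseteq> a"
    by blast
  then show ?thesis
  proof cases
    case 1
    then have "?I = {a}"
      by auto
    then show ?thesis
      using 1 sum by simp
  next
    case 2
    have "(\<Sum>d\<in>?I. (-1) ^ (card a - card d)) = (\<Sum>d\<in>?I. (-1) ^ card a * (-1 :: complex) ^ card d)"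
    proof (rule sum.cong[OF refl])
      fix d assume "d \<in> ?I"
      then have "card d \<le> card a"
        using fin by (auto intro: card_mono)
      then show "(-1) ^ (card a - card d) = (-1) ^ card a * (-1 :: complex) ^ card d"
        by (simp add: minus_one_power_iff)
    qed
    also have "\<dots> = (-1) ^ card a * (\<Sum>d\<in>?I. (-1) ^ card d)"
      by (simp add: sum_distrib_left)
    also have "(\<Sum>d\<in>?I. (-1 :: complex) ^ card d) = 0"
    proof (rule sum_alternating_cancels)
      show "finite ?I"
        by (rule finite_subset[of _ "Pow a"]) (use fin in auto)
      show "card {d \<in> ?I. even (card d)} = card {d \<in> ?I. odd (card d)}"
        using card_subsupersets_even_odd[OF fin 2] by (simp add: conj_ac)
    qed
    finally show ?thesis
      using sum 2 by simp
  next
    case 3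
    then have "?I = {}" "b \<noteq> a"
      by auto
    then show ?thesis
      unfolding sum by (simp only: sum.empty if_False)
  qed
qed

lemma up_sum_expand:
  assumes "A \<subseteq> Pnc n c"
  shows "up_sum n c (\<lambda>d. \<Sum>a\<in>A. F a * xd n c a d) b = (if b \<in> A then F b else 0)"
proof -
  have "finite A"
    using assms finite_Pnc finite_subset by blast
  moreover have "up_sum n c (\<lambda>d. \<Sum>a\<in>A. F a * xd n c a d) b = (\<Sum>a\<in>A. if a = b then F b else 0)"
    unfolding up_sum_sum up_sum_scale using assms
    by (intro sum.cong refl) (auto simp: up_sum_xd subset_iff)
  ultimately show ?thesis
    by simp
qed

lemma combination_carrier: "(\<lambda>d. \<Sum>a\<in>A. F a * xd n c a d) \<in> CP_carrier n c"
  using xd_carrier by (fastforce simp: CP_carrier_def intro: sum.neutral)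

lemma sum_fun_apply: "(\<Sum>a\<in>A. f a) x = (\<Sum>a\<in>A. f a x)"
  for f :: "'a \<Rightarrow> 'b \<Rightarrow> 'c::comm_monoid_add"
  by (induction A rule: infinite_finite_induct) auto

text \<open>In the coordinates \<open>up_sum\<close> a span of some of the x_a is a coordinate
  subspace, cut out by the vanishing of the remaining coordinates. This form can be compared with
  columns of matrices.\<close>

lemma complex_span_xd:
  assumes A: "A \<subseteq> Pnc n c"
  shows "complex_span (xd n c ` A) = {f \<in> CP_carrier n c. \<forall>a. up_sum n c f a \<noteq> 0 \<longrightarrow> a \<in> A}"
    (is "_ = ?W")
proof -
  interpret V: Modules.module "\<lambda>(z::complex) (f :: diagram \<Rightarrow> complex) d. z * f d"
    by standard (auto simp: fun_eq_iff algebra_simps)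
  have "V.subspace ?W"
    unfolding V.subspace_def
  proof (intro conjI ballI allI)
    show "0 \<in> ?W"
      by (auto simp: CP_carrier_def up_sum_def cong: if_cong)
    show "f + g \<in> ?W" if "f \<in> ?W" "g \<in> ?W" for f g
    proof -
      have "f + g = (\<lambda>d. f d + g d)"
        by auto
      then show ?thesis
        using that by (auto simp: CP_carrier_def up_sum_add) (metis add_0)
    qed
    show "(\<lambda>d. z * f d) \<in> ?W" if "f \<in> ?W" for z f
      using that by (auto simp: CP_carrier_def up_sum_scale)
  qed
  moreover have "xd n c ` A \<subseteq> ?W"
    using A by (auto simp: xd_carrier up_sum_xd subset_iff split: if_splits)
  ultimately have "V.span (xd n c ` A) \<subseteq> ?W"
    by (intro V.span_minimal)
  moreover have "?W \<subseteq> V.span (xd n c ` A)"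
  proof
    fix f assume f: "f \<in> ?W"
    have "f = (\<lambda>d. \<Sum>a\<in>A. up_sum n c f a * xd n c a d)"
      by (rule up_sum_inject[OF _ combination_carrier])
         (use f in \<open>auto simp: up_sum_expand[OF A]\<close>)
    also have "\<dots> = (\<Sum>a\<in>A. (\<lambda>d. up_sum n c f a * xd n c a d))"
      by (simp add: fun_eq_iff sum_fun_apply)
    also have "\<dots> \<in> V.span (xd n c ` A)"
      by (intro V.span_sum V.span_scale V.span_base imageI)
    finally show "f \<in> V.span (xd n c ` A)" .
  qed
  ultimately show ?thesis
    by (auto simp: complex_span_def)
qed


subsection \<open>The algebra in matrix form\<close>

definition type_mat ::
    "nat \<Rightarrow> nat \<Rightarrow> (diagram \<Rightarrow> complex) \<Rightarrow> nat set list \<Rightarrow> nat set list \<Rightarrow> complex"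
  where "type_mat n c f S T =
    (if S \<in> Xn n c \<and> T \<in> Xn n c \<and> map card S = map card T then up_sum n c f (link c S T) else 0)"

lemma type_mat_beta:
  assumes "a \<in> Pnc n c"
  shows "type_mat n c f (beta n c (flip a)) (beta n c a) = up_sum n c f a"
  using assms by (simp add: type_mat_def beta_in_Xn Pnc_flip card_beta_flip link_beta)

lemma beta_flip_link:
  assumes "S \<in> Xn n c" "T \<in> Xn n c" "map card S = map card T"
  shows "beta n c (flip (link c S T)) = S"
proof -
  have "flip (link c S T) = link c T S"
    by (auto simp: flip_def link_def)
  then show ?thesis
    using beta_link[OF assms(2,1)] assms(3) by simp
qed

text \<open>Every coordinate with respect to the x_a occurs as an entry, at the position given by
  the top and bottom types of a, which gives injectivity. Conversely the entries of a block matrix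
  may be used as coefficients of the x_a, giving surjectivity.\<close>

lemma bij_type_mat: "bij_betw (type_mat n c) (CP_carrier n c) (block_matrices (Xn n c) (map card))"
proof (rule bij_betwI')
  fix f g assume f: "f \<in> CP_carrier n c" and g: "g \<in> CP_carrier n c"
  show "type_mat n c f = type_mat n c g \<longleftrightarrow> f = g"
    using up_sum_inject[OF f g] type_mat_beta by metis
next
  fix f
  show "type_mat n c f \<in> block_matrices (Xn n c) (map card)"
    by (auto simp: block_matrices_def type_mat_def split: if_splits)
next
  fix F :: "nat set list \<Rightarrow> nat set list \<Rightarrow> complex"
  assume F: "F \<in> block_matrices (Xn n c) (map card)"
  let ?f = "\<lambda>d. \<Sum>a\<in>Pnc n c. F (beta n c (flip a)) (beta n c a) * xd n c a d"
  have "F S T = type_mat n c ?f S T" for S T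
  proof (cases "S \<in> Xn n c \<and> T \<in> Xn n c \<and> map card S = map card T")
    case True
    then show ?thesis
      by (simp add: type_mat_def up_sum_expand[OF order_refl] link_Pnc beta_link beta_flip_link)
  next
    case False
    then show ?thesis
      using F unfolding block_matrices_def type_mat_def by auto
  qed
  then have "F = type_mat n c ?f"
    by blast
  then show "\<exists>f\<in>CP_carrier n c. F = type_mat n c f"
    by (intro bexI[of _ ?f] combination_carrier)
qed

text \<open>Each pair of diagrams has exactly one product, which is again a diagram, so summing over
  the value of the product collapses.\<close>

lemma up_sum_mult:
  "up_sum n c (CP_mult n c f g) a
    = (\<Sum>d\<in>Pnc n c. \<Sum>e\<in>Pnc n c. if a \<subseteq> diagram_mult d e then f d * g e else 0)"
proof -
  let ?P = "Pnc n c"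
  have mult: "CP_mult n c f g d
      = (\<Sum>(d1, d2)\<in>?P \<times> ?P. if diagram_mult d1 d2 = d then f d1 * g d2 else 0)" for d
  proof -
    have "{(d1, d2) \<in> ?P \<times> ?P. diagram_mult d1 d2 = d}
        = {p \<in> ?P \<times> ?P. diagram_mult (fst p) (snd p) = d}"
      by auto
    then show ?thesis
      unfolding CP_mult_def using finite_Pnc
      by (simp add: sum.inter_filter split_beta)
  qed
  have "up_sum n c (CP_mult n c f g) a = (\<Sum>d\<in>?P. \<Sum>p\<in>?P \<times> ?P.
      if diagram_mult (fst p) (snd p) = d then
        if a \<subseteq> diagram_mult (fst p) (snd p) then f (fst p) * g (snd p) else 0 else 0)"
    unfolding up_sum_def mult
  proof (intro sum.cong[OF refl])
    show "(if a \<subseteq> d then \<Sum>(d1, d2)\<in>?P \<times> ?P. if diagram_mult d1 d2 = d then f d1 * g d2 else 0 else 0)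
        = (\<Sum>p\<in>?P \<times> ?P. if diagram_mult (fst p) (snd p) = d then
            if a \<subseteq> diagram_mult (fst p) (snd p) then f (fst p) * g (snd p) else 0 else 0)" for d
      by (cases "a \<subseteq> d") (simp_all add: split_beta cong: if_cong)
  qed
  also have "\<dots> = (\<Sum>p\<in>?P \<times> ?P. \<Sum>d\<in>?P.
      if diagram_mult (fst p) (snd p) = d then
        if a \<subseteq> diagram_mult (fst p) (snd p) then f (fst p) * g (snd p) else 0 else 0)"
    by (rule sum.swap)
  also have "\<dots> = (\<Sum>p\<in>?P \<times> ?P.
      if a \<subseteq> diagram_mult (fst p) (snd p) then f (fst p) * g (snd p) else 0)"
    using finite_Pnc Pnc_mult by (intro sum.cong) auto
  also have "\<dots> = (\<Sum>d\<in>?P. \<Sum>e\<in>?P. if a \<subseteq> diagram_mult d e then f d * g e else 0)"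
    by (simp add: sum.cartesian_product split_beta)
  finally show ?thesis .
qed

lemma sum_at_most_one:
  assumes "finite A" "\<And>x y. x \<in> A \<Longrightarrow> y \<in> A \<Longrightarrow> Q x \<Longrightarrow> Q y \<Longrightarrow> x = y"
  shows "(\<Sum>x\<in>A. if Q x then h else 0) = (if \<exists>x\<in>A. Q x then h else 0)"
proof (cases "\<exists>x\<in>A. Q x")
  case True
  then obtain x where x: "x \<in> A" "Q x" ..
  then have "(\<Sum>y\<in>A. if Q y then h else 0) = (\<Sum>y\<in>A. if y = x then h else 0)"
    using assms(2) by (intro sum.cong) auto
  then show ?thesis
    using x assms(1) by auto
qed (auto intro: sum.neutral)

text \<open>After interchanging the sums, the coefficient of f d * g e on the right is the number of
  middle types U with \<open>link c S U\<close> in d and \<open>link c U T\<close> in e. This number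
  is 1 if the product of d and e contains \<open>link c S T\<close>, and 0 otherwise.\<close>

lemma type_mat_mult:
  "type_mat n c (CP_mult n c f g) S T = (\<Sum>U\<in>Xn n c. type_mat n c f S U * type_mat n c g U T)"
proof (cases "S \<in> Xn n c \<and> T \<in> Xn n c \<and> map card S = map card T")
  case False
  \<comment> \<open>If both factors were nonzero, S and T would be types with the cardinalities of
    U, hence with the same cardinalities.\<close>
  then have "type_mat n c f S U * type_mat n c g U T = 0" for U
    by (auto simp: type_mat_def)
  then show ?thesis
    using False by (simp only: sum.neutral_const) (auto simp: type_mat_def)
next
  case True
  then have S: "S \<in> Xn n c" and T: "T \<in> Xn n c" and eq: "map card S = map card T"
    by auto
  let ?P = "Pnc n c"
  let ?Q = "\<lambda>d e U. map card S = map card U \<and> link c S U \<subseteq> d \<and> link c U T \<subseteq> e"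
  have "(\<Sum>U\<in>Xn n c. type_mat n c f S U * type_mat n c g U T)
      = (\<Sum>U\<in>Xn n c. \<Sum>d\<in>?P. \<Sum>e\<in>?P. if ?Q d e U then f d * g e else 0)"
  proof (rule sum.cong[OF refl])
    fix U assume U: "U \<in> Xn n c"
    show "type_mat n c f S U * type_mat n c g U T
        = (\<Sum>d\<in>?P. \<Sum>e\<in>?P. if ?Q d e U then f d * g e else 0)"
    proof (cases "map card S = map card U")
      case True
      then have "type_mat n c f S U * type_mat n c g U T
          = (\<Sum>d\<in>?P. \<Sum>e\<in>?P. (if link c S U \<subseteq> d then f d else 0) * (if link c U T \<subseteq> e then g e else 0))"
        using S T U eq by (simp add: type_mat_def up_sum_def sum_product)
      also have "\<dots> = (\<Sum>d\<in>?P. \<Sum>e\<in>?P. if ?Q d e U then f d * g e else 0)"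
        using True by (intro sum.cong) auto
      finally show ?thesis .
    qed (simp add: type_mat_def)
  qed
  also have "\<dots> = (\<Sum>d\<in>?P. \<Sum>U\<in>Xn n c. \<Sum>e\<in>?P. if ?Q d e U then f d * g e else 0)"
    by (rule sum.swap)
  also have "\<dots> = (\<Sum>d\<in>?P. \<Sum>e\<in>?P. \<Sum>U\<in>Xn n c. if ?Q d e U then f d * g e else 0)"
    by (intro sum.cong[OF refl] sum.swap)
  also have "\<dots> = (\<Sum>d\<in>?P. \<Sum>e\<in>?P. if link c S T \<subseteq> diagram_mult d e then f d * g e else 0)"
  proof (intro sum.cong[OF refl])
    fix d e assume d: "d \<in> ?P" and e: "e \<in> ?P"
    have "(\<Sum>U\<in>Xn n c. if ?Q d e U then f d * g e else 0)
        = (if \<exists>U\<in>Xn n c. ?Q d e U then f d * g e else 0)"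
      by (rule sum_at_most_one[OF finite_Xn]) (metis link_subset_unique S d)
    moreover have "(\<exists>U\<in>Xn n c. ?Q d e U) \<longleftrightarrow> link c S T \<subseteq> diagram_mult d e"
      using link_subset_mult[OF S T] mult_ex_link[OF S T eq d e] by blast
    ultimately show "(\<Sum>U\<in>Xn n c. if ?Q d e U then f d * g e else 0)
        = (if link c S T \<subseteq> diagram_mult d e then f d * g e else 0)"
      by simp
  qed
  also have "\<dots> = type_mat n c (CP_mult n c f g) S T"
    using True by (simp add: type_mat_def up_sum_mult)
  finally show ?thesis ..
qed

lemma CP_mult_closed: "CP_mult n c f g \<in> CP_carrier n c"
  unfolding CP_carrier_def CP_mult_def using Pnc_mult by (auto intro: sum.neutral)

lemma CP_carrier_eqI:
  assumes "f \<in> CP_carrier n c" "g \<in> CP_carrier n c"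
    and "\<And>S T. type_mat n c f S T = type_mat n c g S T"
  shows "f = g"
  using bij_type_mat assms unfolding bij_betw_def inj_on_def by blast

text \<open>The unit of \<open>CP\<close> is a definite description, so existence and uniqueness are
  both owed. The preimage of the identity matrix is a two-sided unit, and two-sided units
  coincide.\<close>

lemma CP_one:
  shows CP_one_closed: "one (CP n c) \<in> CP_carrier n c"
    and type_mat_one:
      "type_mat n c (one (CP n c)) S T = (if S = T \<and> S \<in> Xn n c then 1 else 0)"
proof -
  have "(\<lambda>S T. if S = T \<and> S \<in> Xn n c then 1 else 0) \<in> block_matrices (Xn n c) (map card)"
    by (auto simp: block_matrices_def)
  then have "(\<lambda>S T. if S = T \<and> S \<in> Xn n c then 1 else 0) \<in> type_mat n c ` CP_carrier n c"
    using bij_type_mat by (simp add: bij_betw_def)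
  then obtain u where u: "u \<in> CP_carrier n c"
    and "type_mat n c u = (\<lambda>S T. if S = T \<and> S \<in> Xn n c then 1 else 0)"
    by (elim imageE) simp
  then have mat_u: "type_mat n c u S T = (if S = T \<and> S \<in> Xn n c then 1 else 0)" for S T
    by simp
  have unit: "CP_mult n c u f = f \<and> CP_mult n c f u = f" if f: "f \<in> CP_carrier n c" for f
  proof (intro conjI CP_carrier_eqI)
    fix S T
    have "type_mat n c (CP_mult n c u f) S T = (\<Sum>U\<in>Xn n c. if U = S then type_mat n c f S T else 0)"
      unfolding type_mat_mult mat_u by (rule sum.cong) auto
    then show "type_mat n c (CP_mult n c u f) S T = type_mat n c f S T"
      using finite_Xn by (auto simp: type_mat_def)
    have "type_mat n c (CP_mult n c f u) S T = (\<Sum>U\<in>Xn n c. if U = T then type_mat n c f S T else 0)"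
      unfolding type_mat_mult mat_u by (rule sum.cong) auto
    then show "type_mat n c (CP_mult n c f u) S T = type_mat n c f S T"
      using finite_Xn by (auto simp: type_mat_def)
  qed (simp_all add: CP_mult_closed f)
  have "one (CP n c) = u"
    unfolding CP_def monoid.simps
  proof (rule the_equality)
    show "u \<in> CP_carrier n c \<and> (\<forall>f\<in>CP_carrier n c. CP_mult n c u f = f \<and> CP_mult n c f u = f)"
      using u unit by blast
    fix v
    assume v: "v \<in> CP_carrier n c \<and> (\<forall>f\<in>CP_carrier n c. CP_mult n c v f = f \<and> CP_mult n c f v = f)"
    then have "v = CP_mult n c u v"
      using unit by simp
    also have "\<dots> = u"
      using u v by simp
    finally show "v = u" .
  qed
  then show "one (CP n c) \<in> CP_carrier n c"
    and "type_mat n c (one (CP n c)) S T = (if S = T \<and> S \<in> Xn n c then 1 else 0)"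
    using u mat_u by simp_all
qed

lemma block_matrix_ring_CP: "block_matrix_ring (CP n c) (Xn n c) (map card) (type_mat n c)"
proof (intro block_matrix_ring.intro block_matrix_ring_axioms.intro)
  show "abelian_group (CP n c)"
  proof (rule abelian_groupI)
    fix f assume "f \<in> carrier (CP n c)"
    then show "\<exists>g\<in>carrier (CP n c). g \<oplus>\<^bsub>CP n c\<^esub> f = \<zero>\<^bsub>CP n c\<^esub>"
      by (intro bexI[of _ "\<lambda>d. - f d"]) (auto simp: CP_def CP_carrier_def)
  qed (auto simp: CP_def CP_carrier_def algebra_simps)
  show "\<one>\<^bsub>CP n c\<^esub> \<in> carrier (CP n c)"
    using CP_one_closed by (simp add: CP_def)
  show "type_mat n c (f \<oplus>\<^bsub>CP n c\<^esub> g) S T = type_mat n c f S T + type_mat n c g S T" for f g S T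
    by (simp add: CP_def type_mat_def up_sum_add)
qed (use finite_Xn bij_type_mat CP_mult_closed type_mat_mult type_mat_one in \<open>auto simp: CP_def\<close>)

section \<open>The modules W as columns, and the enumeration of types\<close>

lemma span_xd_cols:
  "complex_span {xd n c a | a. a \<in> Pnc n c \<and> beta n c a \<in> J}
    = block_matrix_ring.cols (CP n c) (type_mat n c) J"
proof -
  interpret block_matrix_ring "CP n c" "Xn n c" "map card" "type_mat n c"
    by (rule block_matrix_ring_CP)
  have set_eq: "{xd n c a | a. a \<in> Pnc n c \<and> beta n c a \<in> J} = xd n c ` {a \<in> Pnc n c. beta n c a \<in> J}"
    by auto
  \<comment> \<open>The coordinate at a sits in column \<open>beta n c a\<close>, so conditions on
    bottom types are conditions on columns.\<close>
  have "(\<forall>a. up_sum n c f a \<noteq> 0 \<longrightarrow> a \<in> Pnc n c \<and> beta n c a \<in> J)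
      \<longleftrightarrow> (\<forall>S T. T \<notin> J \<longrightarrow> type_mat n c f S T = 0)" for f
  proof
    assume L: "\<forall>a. up_sum n c f a \<noteq> 0 \<longrightarrow> a \<in> Pnc n c \<and> beta n c a \<in> J"
    show "\<forall>S T. T \<notin> J \<longrightarrow> type_mat n c f S T = 0"
      using L beta_link unfolding type_mat_def by metis
  next
    assume R: "\<forall>S T. T \<notin> J \<longrightarrow> type_mat n c f S T = 0"
    show "\<forall>a. up_sum n c f a \<noteq> 0 \<longrightarrow> a \<in> Pnc n c \<and> beta n c a \<in> J"
      using R type_mat_beta up_sum_nonzeroD by metis
  qed
  then show ?thesis
    unfolding set_eq cols_def by (subst complex_span_xd) (auto simp: CP_def)
qed

lemma WnT_cols: "WnT n c T = block_matrix_ring.cols (CP n c) (type_mat n c) {T}"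
  using span_xd_cols[of n c "{T}"] by (simp add: WnT_def)

lemma beta_in_Xnk:
  assumes "d \<in> Pnc n c"
  shows "beta n c d \<in> Xnk n c k \<longleftrightarrow> card d = k"
  unfolding Xnk_def mem_Collect_eq sum_card_beta[OF assms] using beta_in_Xn[OF assms] by simp

lemma Wnk_cols: "Wnk n c k = block_matrix_ring.cols (CP n c) (type_mat n c) (Xnk n c k)"
proof -
  have "{xd n c a | a. a \<in> Pnc n c \<and> diagram_size a = k}
      = {xd n c a | a. a \<in> Pnc n c \<and> beta n c a \<in> Xnk n c k}"
    using beta_in_Xnk by blast
  then show ?thesis
    using span_xd_cols[of n c "Xnk n c k"] by (simp add: Wnk_def)
qed

lemma Union_Xnk: "(\<Union>k\<in>{0..n}. Xnk n c k) = Xn n c"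
proof -
  have "card d \<le> n" if d: "d \<in> Pnc n c" for d
  proof -
    have "card d = card {j. \<exists>i r. (i, j, r) \<in> d}"
      using card_bottom[OF d] by simp
    also have "\<dots> \<le> card {1..n}"
      using Pnc_range(2)[OF d] by (intro card_mono) auto
    finally show ?thesis
      by simp
  qed
  then have "\<exists>k\<in>{0..n}. beta n c d \<in> Xnk n c k" if "d \<in> Pnc n c" for d
    using that by (intro bexI[of _ "card d"]) (auto simp: beta_in_Xnk)
  moreover have "Xnk n c k \<subseteq> Xn n c" for k
    by (auto simp: Xnk_def)
  ultimately show ?thesis
    by (auto simp: Xn_def)
qed

text \<open>The types with cardinalities \<open>ns\<close> are numbered below
  \<open>multinomial ns\<close>. This indexes all columns by the set that also indexes the summands,
  copies included; \<open>ns\<close> can be recovered from a type, so different classes do not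
  overlap.\<close>

lemma ex_type_enumeration:
  "\<exists>e. bij_betw (\<lambda>(ns, m). e ns m) (SIGMA ns:weak_compositions n c. {..<multinomial ns}) (Xn n c)
    \<and> (\<forall>ns\<in>weak_compositions n c. \<forall>m<multinomial ns. map card (e ns m) = ns)"
proof -
  let ?X = "\<lambda>ns. {T \<in> Xn n c. map card T = ns}"
  have "\<exists>b. bij_betw b {..<multinomial ns} (?X ns)" if "ns \<in> weak_compositions n c" for ns
    using ex_bij_betw_nat_finite[of "?X ns"] finite_Xn[of n c] card_Xn_type[OF that]
    by (simp add: atLeast0LessThan)
  then obtain e where e: "\<And>ns. ns \<in> weak_compositions n c \<Longrightarrow> bij_betw (e ns) {..<multinomial ns} (?X ns)"
    by metis
  have in_X: "e ns m \<in> ?X ns" if "ns \<in> weak_compositions n c" "m < multinomial ns" for ns m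
    using bij_betwE[OF e[OF that(1)]] that(2) by simp
  have "bij_betw (\<lambda>(ns, m). e ns m) (SIGMA ns:weak_compositions n c. {..<multinomial ns}) (Xn n c)"
  proof (rule bij_betwI')
    fix p q assume p: "p \<in> (SIGMA ns:weak_compositions n c. {..<multinomial ns})"
      and q: "q \<in> (SIGMA ns:weak_compositions n c. {..<multinomial ns})"
    obtain ns m ns' m' where [simp]: "p = (ns, m)" "q = (ns', m')"
      by (cases p, cases q)
    have "ns = ns' \<and> m = m'" if "e ns m = e ns' m'"
    proof -
      have "ns = ns'"
        using in_X[of ns m] in_X[of ns' m'] p q that by simp
      then show ?thesis
        using bij_betw_imp_inj_on[OF e[of ns]] p q that by (auto simp: inj_on_def)
    qed
    then show "(case p of (ns, m) \<Rightarrow> e ns m) = (case q of (ns, m) \<Rightarrow> e ns m) \<longleftrightarrow> p = q"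
      by auto
  next
    fix T assume T: "T \<in> Xn n c"
    then have "T \<in> e (map card T) ` {..<multinomial (map card T)}"
      using e[OF map_card_Xn[OF T]] by (auto simp: bij_betw_def)
    then obtain m where "m < multinomial (map card T)" "T = e (map card T) m"
      by auto
    then show "\<exists>p\<in>SIGMA ns:weak_compositions n c. {..<multinomial ns}. T = (case p of (ns, m) \<Rightarrow> e ns m)"
      using map_card_Xn[OF T] by (intro bexI[of _ "(map card T, m)"]) auto
  qed (use in_X in auto)
  then show ?thesis
    using in_X by blast
qed

lemma finite_weak_compositions: "finite (weak_compositions n c)"
proof (rule finite_subset)
  show "weak_compositions n c \<subseteq> {ns. set ns \<subseteq> {..n} \<and> length ns = c + 1}"
    using member_le_sum_list by (fastforce simp: weak_compositions_def)
qed (rule finite_lists_length_eq, simp)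

theorem theorem3p6:
  fixes n c :: nat
    and \<tau> :: "nat list \<Rightarrow> nat set list"
  assumes "c \<ge> 1"
    and "is_choice n c \<tau>"
  shows
    "internal_direct_sum (CP n c) (regular_module (CP n c)) {0..n} (Wnk n c) \<and>
     (\<forall>k \<in> {0..n}. internal_direct_sum (CP n c)
        (restrict_module (regular_module (CP n c)) (Wnk n c k)) (Xnk n c k) (WnT n c)) \<and>
     internal_direct_sum (CP n c) (regular_module (CP n c))
        (SIGMA k:{0..n}. Xnk n c k) (\<lambda>(k, T). WnT n c T) \<and>
     (\<forall>T \<in> Xn n c. irreducible_module (CP n c) (W_module n c T)) \<and>
     module_isomorphic (CP n c) (regular_module (CP n c))
        (direct_sum_module (SIGMA ns:weak_compositions n c. {..<multinomial ns})
          (\<lambda>(ns, m). W_module n c (\<tau> ns))) \<and>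
     (\<forall>ns \<in> weak_compositions n c. irreducible_module (CP n c) (W_module n c (\<tau> ns))) \<and>
     (\<forall>M :: (diagram \<Rightarrow> complex, 'm) module. irreducible_module (CP n c) M \<longrightarrow>
        (\<exists>ns \<in> weak_compositions n c. module_isomorphic (CP n c) M (W_module n c (\<tau> ns))))"
proof -
  interpret block_matrix_ring "CP n c" "Xn n c" "map card" "type_mat n c"
    by (rule block_matrix_ring_CP)
  have \<tau>: "\<tau> ns \<in> Xn n c" "map card (\<tau> ns) = ns" if "ns \<in> weak_compositions n c" for ns
    using assms(2) that by (auto simp: is_choice_def)
  have finite_Xnk: "finite (Xnk n c k)" for k
    using finite_Xn[of n c] by (simp add: Xnk_def)
  have disjoint: "disjoint_family_on (Xnk n c) {0..n}"
    by (auto simp: disjoint_family_on_def Xnk_def)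
  obtain e where e: "bij_betw (\<lambda>(ns, m). e ns m)
      (SIGMA ns:weak_compositions n c. {..<multinomial ns}) (Xn n c)"
    "\<forall>ns\<in>weak_compositions n c. \<forall>m<multinomial ns. map card (e ns m) = ns"
    using ex_type_enumeration by blast
  have "internal_direct_sum (CP n c) (regular_module (CP n c)) {0..n} (Wnk n c)"
    using internal_direct_sum_cols[OF _ disjoint Union_Xnk]
    by (simp add: cols_module_all Wnk_cols[abs_def])
  moreover have "internal_direct_sum (CP n c)
      (restrict_module (regular_module (CP n c)) (Wnk n c k)) (Xnk n c k) (WnT n c)" for k
    using internal_direct_sum_cols[OF finite_Xnk, of "\<lambda>T. {T}" k "Xnk n c k"]
    by (simp add: Wnk_cols WnT_cols[abs_def] disjoint_family_on_def)
  moreover have "internal_direct_sum (CP n c) (regular_module (CP n c))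
      (SIGMA k:{0..n}. Xnk n c k) (\<lambda>(k, T). WnT n c T)"
  proof -
    have "internal_direct_sum (CP n c) (cols_module (Xn n c)) (SIGMA k:{0..n}. Xnk n c k)
        (\<lambda>p. cols {snd p})"
    proof (rule internal_direct_sum_cols)
      show "(\<Union>p\<in>SIGMA k:{0..n}. Xnk n c k. {snd p}) = Xn n c"
        unfolding Union_Xnk[symmetric] by force
      \<comment> \<open>Two indices with the same T agree, because k is the number of coloured
        vertices in T.\<close>
      show "disjoint_family_on (\<lambda>p. {snd p}) (SIGMA k:{0..n}. Xnk n c k)"
        by (auto simp: disjoint_family_on_def Xnk_def)
    qed (use finite_Xnk in simp)
    moreover have "(\<lambda>(k :: nat, T). WnT n c T) = (\<lambda>p. cols {snd p})"
      by (auto simp: WnT_cols)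
    ultimately show ?thesis
      by (simp only: cols_module_all)
  qed
  moreover have "irreducible_module (CP n c) (W_module n c T)" if "T \<in> Xn n c" for T
    using irreducible_col[OF that] by (simp add: WnT_cols)
  moreover have "module_isomorphic (CP n c) (regular_module (CP n c))
      (direct_sum_module (SIGMA ns:weak_compositions n c. {..<multinomial ns})
        (\<lambda>(ns, m). W_module n c (\<tau> ns)))"
  proof -
    \<comment> \<open>The index (ns, m) represents the column \<open>e ns m\<close>, but its summand
      is the column \<open>\<tau> ns\<close>, which has the same cardinalities.\<close>
    have "module_isomorphic (CP n c) (regular_module (CP n c))
        (direct_sum_module (SIGMA ns:weak_compositions n c. {..<multinomial ns})
          (\<lambda>p. cols_module {\<tau> (fst p)}))"
      by (rule regular_module_iso_direct_sum[OF _ e(1)])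
         (use \<tau> e(2) finite_weak_compositions in auto)
    then show ?thesis
      by (simp add: WnT_cols case_prod_beta')
  qed
  \<comment> \<open>The choice \<open>\<tau>\<close> itself serves as the selection of one column
    per class, and the class \<open>map card T\<close> of the column found is the required weak
    composition.\<close>
  moreover have "\<exists>ns\<in>weak_compositions n c. module_isomorphic (CP n c) M (W_module n c (\<tau> ns))"
    if "irreducible_module (CP n c) M" for M :: "(diagram \<Rightarrow> complex, 'm) module"
    using irreducible_iso_col[OF that, of \<tau>] \<tau> map_card_Xn by (auto simp: WnT_cols)
  ultimately show ?thesis
    using \<tau>(1) by blast
qed

end
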